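(* Let $g:[0,1]\to\mathbb{R}$ be a strictly decreasing $C^1$ function with $g(0)=1$ and $g(1)=0$, and for each $n\in\mathbb{N}_+$ let $\sigma_n\sim\mathrm{PERM}(g,n)$ be a $g$-random permutation of $[n]$. Then for every $k\in\mathbb{N}$ and every $\tau\in S_k$, $$t(\tau,\sigma_n)\stackrel{\mathbb{P}}{\longrightarrow}t(\tau,\mu_g)\qquad\text{as }n\to\infty,$$ where $\mu_g$ is the permuton arising from $g$, $t(\cdot,\cdot)$ denotes pattern density, and $\stackrel{\mathbb{P}}{\longrightarrow}$ denotes convergence in probability.
   Context: $[n]=\{1,\dots,n\}$ and $S_n$ is the set of permutations of $[n]$. A permuton is a probability measure on $[0,1]^2$ both of whose marginals are uniform on $[0,1]$. **$g$-random permutation.** Let $g$ be a strictly decreasing $C^1[0,1]$ function with $g(0)=1$, $g(1)=0$. For $n\in\mathbb{N}_+$ and $i\in[n]$ let $\nu_g^{(n),i}$ be the probability distribution on $[n-(i-1)]$ with $$\nu_g^{(n),i}(\{l\})=\frac{g\left(\frac{(i-1)+(l-1)}{n}\right)-g\left(\frac{(i-1)+l}{n}\right)}{g\left(\frac{i-1}{n}\right)},\qquad l=1,\dots,n-(i-1).$$ Let $C^{(n),i}$, $i\in[n]$, be independent with $C^{(n),i}\sim\nu_g^{(n),i}$. Define recursively $D^{(n)}_1=[n]$; given $D^{(n)}_i$ (a set of size $n-(i-1)$), let $\sigma_n(i)$ be the $C^{(n),i}$-th smallest element of $D^{(n)}_i$ and $D^{(n)}_{i+1}=D^{(n)}_i\setminus\{\sigma_n(i)\}$.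 The law of the resulting random permutation $\sigma_n\in S_n$ is denoted $\mathrm{PERM}(g,n)$. **The permuton $\mu_g$.** Let $u(x)=\int_0^x\frac{1}{g(z)}\,dz$ for $x\in[0,1)$ (one has $u(x)\to+\infty$ as $x\to1_-$), and define $V_g(x,y)=u^{-1}(u(x)+u(y))$ for $(x,y)\in[0,1)^2$, extended to $[0,1]^2$ by $V_g(1,y)=V_g(x,1)=1$. Then $F_g(x,y)=x+y-V_g(x,y)$ is the joint c.d.f. of a permuton, denoted $\mu_g$. **Pattern densities.** For $\tau\in S_k$, $\sigma\in S_n$, $k\le n$, $t(\tau,\sigma)$ is the fraction of $k$-tuples $1\le i_1<\dots<i_k\le n$ for which the relative order of $\sigma(i_1),\dots,\sigma(i_k)$ is given by $\tau$, i.e. $\sigma(i_a)<\sigma(i_b)$ if and only if $\tau(a)<\tau(b)$ for all $a,b\in[k]$. For a permuton $\mu$, $t(\tau,\mu)$ is the probability that, for i.i.d. points $(X_1,Y_1),\dots,(X_k,Y_k)$ with distribution $\mu$, the relative order of the $Y$'s with respect to the $X$'s is given by $\tau$, i.e. for each $a\in[k]$ the point with the $a$-th smallest $X$-coordinate has the $\tau(a)$-th smallest $Y$-coordinate (ties have probability zero). *)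

theory Defs
  imports "HOL-Probability.Probability" "HOL-Combinatorics.Permutations"
begin

text \<open>
  \<open>S\<^sub>n\<close> is \<open>{\<sigma>. \<sigma> permutes {1..n}}\<close>: a permutation of \<open>[n]\<close> is a function on \<open>nat\<close> that is the
  identity off \<open>{1..n}\<close>.
\<close>

subsection \<open>The random permutation\<close>

definition nu_weight :: "(real \<Rightarrow> real) \<Rightarrow> nat \<Rightarrow> nat \<Rightarrow> nat \<Rightarrow> real" where
  "nu_weight g n i l =
     (if l \<in> {1..n - (i - 1)}
      then (g (((real i - 1) + (real l - 1)) / real n) - g (((real i - 1) + real l) / real n))
             / g ((real i - 1) / real n)
      else 0)"

definition nu :: "(real \<Rightarrow> real) \<Rightarrow> nat \<Rightarrow> nat \<Rightarrow> nat pmf" where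
  "nu g n i = embed_pmf (nu_weight g n i)"

text \<open>\<open>embed_pmf\<close> is only meaningful for nonnegative weights of total mass 1; they are so here.\<close>

lemma pmf_nu:
  assumes dec: "strict_antimono_on {0..1} g" and "g 1 = 0" and i: "i \<in> {1..n}"
  shows "pmf (nu g n i) l = nu_weight g n i l"
proof -
  from i obtain j where j: "i = Suc j" "j < n" by (cases i) auto
  have mono: "g y \<le> g x" if "0 \<le> x" "x \<le> y" "y \<le> 1" for x y
    using that dec by (cases "x = y") (auto simp: monotone_on_def intro!: less_imp_le)
  have pos: "g (real j / real n) > 0"
    using monotone_onD[OF dec, of "real j / real n" 1] j \<open>g 1 = 0\<close> by simp
  have weight: "nu_weight g n i m =
      (if m \<in> {1..n - j} then (g (real (j + (m - 1)) / real n) - g (real (j + m) / real n))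
         / g (real j / real n) else 0)" for m
    unfolding nu_weight_def using j by (auto simp: of_nat_diff add_diff_eq)
  have nonneg: "0 \<le> nu_weight g n i m" for m
  proof (cases "m \<in> {1..n - j}")
    case True
    then have "j + m \<le> n" using j by auto
    then have "real (j + m) / real n \<le> 1" using j
      by (simp only: divide_le_eq_1 of_nat_le_iff of_nat_0_less_iff) auto
    then have "g (real (j + m) / real n) \<le> g (real (j + (m - 1)) / real n)"
      by (intro mono) (auto intro: divide_right_mono)
    then show ?thesis unfolding weight using pos True by (simp del: of_nat_add)
  next
    case False
    then show ?thesis by (auto simp: weight)
  qed
  have "(\<Sum>m=1..n - j. nu_weight g n i m) =
      (\<Sum>m=1..n - j. g (real (j + (m - 1)) / real n) - g (real (j + m) / real n)) / g (real j / real n)"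
    by (simp add: weight sum_divide_distrib)
  also have "(\<Sum>m=1..n - j. g (real (j + (m - 1)) / real n) - g (real (j + m) / real n)) =
      (\<Sum>m<n - j. g (real (j + m) / real n) - g (real (j + Suc m) / real n))"
    by (rule sum.reindex_bij_witness[of _ Suc "\<lambda>m. m - 1"]) auto
  also have "\<dots> = g (real j / real n) - g 1"
    using j sum_lessThan_telescope'[of "\<lambda>m. g (real (j + m) / real n)" "n - j"] by simp
  finally have total: "(\<Sum>m=1..n - j. nu_weight g n i m) = 1"
    using pos \<open>g 1 = 0\<close> by simp
  have "(\<integral>\<^sup>+ m. ennreal (nu_weight g n i m) \<partial>count_space UNIV) =
      (\<Sum>m=1..n - j. ennreal (nu_weight g n i m))"
    by (rule nn_integral_count_space'[of "{1..n - j}"]) (auto simp: weight)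
  also have "\<dots> = 1"
    using total by (simp add: sum_ennreal nonneg)
  finally show ?thesis
    unfolding nu_def using nonneg by (subst pmf_embed_pmf) auto
qed

definition kth_smallest :: "nat set \<Rightarrow> nat \<Rightarrow> nat" where
  "kth_smallest D l = sorted_list_of_set D ! (l - 1)"

text \<open>\<open>remaining n c i\<close> is the set \<open>D\<^sub>i\<^sub>+\<^sub>1\<close>, i.e. what is left of \<open>[n]\<close> after the first \<open>i\<close> choices.\<close>

primrec remaining :: "nat \<Rightarrow> (nat \<Rightarrow> nat) \<Rightarrow> nat \<Rightarrow> nat set" where
  "remaining n c 0 = {1..n}"
| "remaining n c (Suc i) = remaining n c i - {kth_smallest (remaining n c i) (c (Suc i))}"

definition perm_of_choices :: "nat \<Rightarrow> (nat \<Rightarrow> nat) \<Rightarrow> nat \<Rightarrow> nat" where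
  "perm_of_choices n c i =
     (if i \<in> {1..n} then kth_smallest (remaining n c (i - 1)) (c i) else i)"

text \<open>
  \<open>Pi_pmf\<close> is the law of the independent choices; its argument 0 is only the value at indices
  outside \<open>{1..n}\<close>.
\<close>

definition PERM :: "(real \<Rightarrow> real) \<Rightarrow> nat \<Rightarrow> (nat \<Rightarrow> nat) pmf" where
  "PERM g n = map_pmf (perm_of_choices n) (Pi_pmf {1..n} 0 (nu g n))"

subsection \<open>The limiting permuton\<close>

definition permuton :: "(real \<times> real) measure \<Rightarrow> bool" where
  "permuton \<mu> \<longleftrightarrow> prob_space \<mu> \<and> sets \<mu> = sets borel \<and> measure \<mu> ({0..1} \<times> {0..1}) = 1 \<and>
     distr \<mu> borel fst = uniform_measure lborel {0..1} \<and>
     distr \<mu> borel snd = uniform_measure lborel {0..1}"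

definition u_fun :: "(real \<Rightarrow> real) \<Rightarrow> real \<Rightarrow> real" where
  "u_fun g x = integral {0..x} (\<lambda>z. 1 / g z)"

definition V_fun :: "(real \<Rightarrow> real) \<Rightarrow> real \<Rightarrow> real \<Rightarrow> real" where
  "V_fun g x y =
     (if x = 1 \<or> y = 1 then 1 else inv_into {0..<1} (u_fun g) (u_fun g x + u_fun g y))"

definition F_fun :: "(real \<Rightarrow> real) \<Rightarrow> real \<Rightarrow> real \<Rightarrow> real" where
  "F_fun g x y = x + y - V_fun g x y"

definition mu_perm :: "(real \<Rightarrow> real) \<Rightarrow> (real \<times> real) measure" where
  "mu_perm g = (THE \<mu>. permuton \<mu> \<and>
     (\<forall>x\<in>{0..1}. \<forall>y\<in>{0..1}. measure \<mu> ({..x} \<times> {..y}) = F_fun g x y))"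

subsection \<open>Pattern densities\<close>

definition increasing_tuples :: "nat \<Rightarrow> nat \<Rightarrow> (nat \<Rightarrow> nat) set" where
  "increasing_tuples k n = {i \<in> {1..k} \<rightarrow>\<^sub>E {1..n}. strict_mono_on {1..k} i}"

definition pattern_density :: "nat \<Rightarrow> (nat \<Rightarrow> nat) \<Rightarrow> nat \<Rightarrow> (nat \<Rightarrow> nat) \<Rightarrow> real" where
  "pattern_density k \<tau> n \<sigma> =
     real (card {i \<in> increasing_tuples k n.
                   \<forall>a\<in>{1..k}. \<forall>b\<in>{1..k}. \<sigma> (i a) < \<sigma> (i b) \<longleftrightarrow> \<tau> a < \<tau> b})
     / real (card (increasing_tuples k n))"

text \<open>\<open>f j\<close> is the \<open>rank_in A f j\<close>-th smallest of the values of \<open>f\<close> on \<open>A\<close>, when these are distinct.\<close>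

definition rank_in :: "'i set \<Rightarrow> ('i \<Rightarrow> real) \<Rightarrow> 'i \<Rightarrow> nat" where
  "rank_in A f j = card {l \<in> A. f l \<le> f j}"

definition permuton_pattern_density ::
    "nat \<Rightarrow> (nat \<Rightarrow> nat) \<Rightarrow> (real \<times> real) measure \<Rightarrow> real" where
  "permuton_pattern_density k \<tau> \<mu> =
     measure (\<Pi>\<^sub>M j\<in>{1..k}. \<mu>)
       {p \<in> space (\<Pi>\<^sub>M j\<in>{1..k}. \<mu>). \<forall>a\<in>{1..k}. \<forall>j\<in>{1..k}.
          rank_in {1..k} (\<lambda>l. fst (p l)) j = a \<longrightarrow> rank_in {1..k} (\<lambda>l. snd (p l)) j = \<tau> a}"

subsection \<open>Convergence in probability\<close>

text \<open>The limit is a constant, so the variables may live on different probability spaces.\<close>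

definition tendsto_in_prob :: "(nat \<Rightarrow> 'a measure) \<Rightarrow> (nat \<Rightarrow> 'a \<Rightarrow> real) \<Rightarrow> real \<Rightarrow> bool" where
  "tendsto_in_prob M X c \<longleftrightarrow>
     (\<forall>\<epsilon>>0. (\<lambda>n. measure (M n) {\<omega> \<in> space (M n). \<bar>X n \<omega> - c\<bar> > \<epsilon>}) \<longlonglongrightarrow> 0)"

end

theory Submission
  imports Defs "HOL-Real_Asymp.Real_Asymp"
begin

text \<open>
  After \<open>i\<close> choices let \<open>A\<^sub>i\<close> be the number of remaining values that are at most \<open>m\<close>. It is a Markov chain,
  and \<open>(i + A\<^sub>i) / n\<close> has conditional mean increment \<open>g ((i + A\<^sub>i) / n) / (n g (i / n))\<close>: this is the Euler
  scheme of \<open>\<partial>\<^sub>x V = g V / g x\<close>, which \<open>V\<^sub>g (x, y)\<close> solves with initial value \<open>y\<close>. As \<open>g\<close> is decreasing the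
  equation is dissipative, so the mean square of \<open>(i + A\<^sub>i) / n - V\<^sub>g (i / n, y)\<close> tends to 0 and the empirical
  distribution function of \<open>\<sigma>\<^sub>n\<close> converges in probability to \<open>F\<^sub>g\<close> at every point.
  Pattern densities of permutations and permutons alike are determined, up to an error \<open>O(k\<^sup>2 / N)\<close>, by the
  masses of the cells of an \<open>N \<times> N\<close> grid, because \<open>k\<close> independent points rarely share a row or a column.
\<close>

subsection \<open>Discretising a random point of the unit square\<close>

text \<open>\<open>mu_perm\<close> is a definite description, so a permuton with distribution
  function \<open>F_fun g\<close> has to be built and shown unique before it can serve as a limit.
  It is built from the quotient that drives the chain: \<open>H s y\<close> = g (V s y) / g s lies
  in [0, 1], decreases in y, and 1 - H integrates over s in [0, x] to x + y - V x y, so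
  \<open>H s\<close> is the tail of the second coordinate given that the first one is s. The
  equation is singular at x = 1, where g vanishes. The mean square estimate therefore stops at x <
  1; at x = 1 all values have been used up and the deviation is exactly 0. Both kinds of density are
  probabilities for k independent copies of one random point: under \<open>mu_g\<close>, and under
  the uniform choice of a point (i / n, \<sigma> i / n). Requiring the sample to come sorted by its
  labels costs a factor k!, which reappears on one side as the number of relabellings and on the
  other as the limit of n^k / (n choose k).\<close>

definition grid_cell :: "nat \<Rightarrow> nat \<Rightarrow> real set" where
  "grid_cell N a = {real a / real N <.. real (Suc a) / real N}"

text \<open>The ceiling minus one matches cells that are open on the left: t = 1 belongs to cell N -
  1, as suits the points i / n with i in {1..n}. For t \<le> 0 the value is 0 by truncation.\<close>

definition cell_index :: "nat \<Rightarrow> real \<Rightarrow> nat" where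
  "cell_index N t = nat (\<lceil>real N * t\<rceil> - 1)"

text \<open>Placements of k points into cells that already decide the pattern: columns increase
  strictly with the label and, for injective \<tau>, rows are distinct and ordered like \<tau>.
  Placements with a shared row or column are left out and make up the discretisation error.\<close>

definition pattern_cells ::
    "nat \<Rightarrow> (nat \<Rightarrow> nat) \<Rightarrow> nat \<Rightarrow> (nat \<Rightarrow> nat \<times> nat) set" where
  "pattern_cells k \<tau> N = {c \<in> {1..k} \<rightarrow>\<^sub>E {..<N} \<times> {..<N}.
     \<forall>a\<in>{1..k}. \<forall>b\<in>{1..k}. (a < b \<longrightarrow> fst (c a) < fst (c b)) \<and>
        (snd (c a) < snd (c b) \<longleftrightarrow> \<tau> a < \<tau> b)}"

lemma finite_pattern_cells: "finite (pattern_cells k \<tau> N)"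
proof (rule finite_subset)
  show "pattern_cells k \<tau> N \<subseteq> {1..k} \<rightarrow>\<^sub>E {..<N} \<times> {..<N}"
    unfolding pattern_cells_def by blast
  show "finite ({1..k} \<rightarrow>\<^sub>E {..<N} \<times> {..<N})"
    by (intro finite_PiE finite_cartesian_product) auto
qed

lemma borel_grid_cell [measurable]: "grid_cell N a \<in> sets borel"
  by (simp add: grid_cell_def)

lemma cell_index_props:
  assumes "N > 0" "t \<in> {0<..1}"
  shows "cell_index N t < N" "t \<in> grid_cell N (cell_index N t)"
proof -
  have pos: "real N * t > 0" and le: "real N * t \<le> real N"
    using assms by (auto simp: mult_left_le)
  define z where "z = \<lceil>real N * t\<rceil>"
  have z: "z \<ge> 1" "z \<le> int N" "real_of_int z - 1 < real N * t" "real N * t \<le> real_of_int z"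
    using pos le unfolding z_def by (linarith | simp add: ceiling_le_iff)+
  have idx: "real (cell_index N t) = real_of_int z - 1" "cell_index N t = nat (z - 1)"
    using z unfolding cell_index_def z_def by (auto simp: of_nat_nat)
  show "cell_index N t < N" using z idx by auto
  show "t \<in> grid_cell N (cell_index N t)"
    unfolding grid_cell_def using z idx assms
    by (auto simp: field_simps)
qed

lemma cell_index_mono: "s \<le> t \<Longrightarrow> cell_index N s \<le> cell_index N t"
  unfolding cell_index_def by (intro nat_mono diff_mono ceiling_mono mult_left_mono) auto

lemma grid_cell_less:
  assumes "s \<in> grid_cell N a" "t \<in> grid_cell N b" "a < b"
  shows "s < t"
proof -
  have "s \<le> real (Suc a) / real N" "real b / real N < t"
    using assms by (auto simp: grid_cell_def)
  moreover have "real (Suc a) / real N \<le> real b / real N"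
    using assms by (intro divide_right_mono) auto
  ultimately show ?thesis by linarith
qed

lemma grid_cell_disjoint: "a \<noteq> b \<Longrightarrow> s \<in> grid_cell N a \<Longrightarrow> s \<notin> grid_cell N b"
  using grid_cell_less[of s N a s b] grid_cell_less[of s N b s a] by (metis less_irrefl nat_neq_iff)

text \<open>A common frame for the two objects to be compared: an index drawn uniformly from {1..n}
  with its position and value divided by n, and the coordinate projections under
  \<open>mu_g\<close>. The coordinate 0 is excluded because the left-open cells cover only (0,
  1].\<close>

locale square_point = prob_space M for M :: "'s measure" +
  fixes X Y :: "'s \<Rightarrow> real"
  assumes measurable_X [measurable]: "X \<in> borel_measurable M"
    and measurable_Y [measurable]: "Y \<in> borel_measurable M"
    and AE_X: "AE s in M. X s \<in> {0<..1}"
    and AE_Y: "AE s in M. Y s \<in> {0<..1}"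
begin

abbreviation iid :: "nat \<Rightarrow> (nat \<Rightarrow> 's) measure" where
  "iid k \<equiv> Pi\<^sub>M {1..k} (\<lambda>_. M)"

definition cell_prob :: "nat \<Rightarrow> nat \<times> nat \<Rightarrow> real" where
  "cell_prob N c = prob {s \<in> space M. X s \<in> grid_cell N (fst c) \<and> Y s \<in> grid_cell N (snd c)}"

definition cdf2 :: "real \<Rightarrow> real \<Rightarrow> real" where
  "cdf2 x y = prob {s \<in> space M. X s \<le> x \<and> Y s \<le> y}"

text \<open>The labels have to agree with the order of the X coordinates. In the empirical case this
  makes the event the set of increasing index tuples with pattern \<tau>; in general it picks one of
  the k! labellings of a sample.\<close>

definition ordered_pattern :: "nat \<Rightarrow> (nat \<Rightarrow> nat) \<Rightarrow> (nat \<Rightarrow> 's) set" where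
  "ordered_pattern k \<tau> = {p \<in> space (iid k).
     \<forall>a\<in>{1..k}. \<forall>b\<in>{1..k}. (a < b \<longrightarrow> X (p a) < X (p b)) \<and>
        (Y (p a) < Y (p b) \<longleftrightarrow> \<tau> a < \<tau> b)}"

lemma prob_space_iid: "prob_space (iid k)"
  by (intro prob_space_PiM prob_space_axioms)

lemma ordered_pattern_sets [measurable]: "ordered_pattern k \<tau> \<in> sets (iid k)"
  unfolding ordered_pattern_def by measurable

lemma measure_iid_box:
  assumes "\<And>j. j \<in> {1..k} \<Longrightarrow> A j \<in> sets M"
  shows "measure (iid k) (\<Pi>\<^sub>E j\<in>{1..k}. A j) = (\<Prod>j\<in>{1..k}. prob (A j))"
proof -
  interpret finite_product_prob_space "\<lambda>_::nat. M" "{1..k}"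
    by unfold_locales auto
  show ?thesis using assms by (intro finite_measure_PiM_emb)
qed

text \<open>Inclusion-exclusion over the four corners. Through it, closeness of two distribution
  functions at finitely many grid points controls all cell masses.\<close>

lemma cell_prob_cdf2:
  assumes "N > 0"
  shows "cell_prob N (a, b) =
    cdf2 (real (Suc a) / N) (real (Suc b) / N) - cdf2 (real a / N) (real (Suc b) / N)
    - cdf2 (real (Suc a) / N) (real b / N) + cdf2 (real a / N) (real b / N)"
proof -
  let ?S = "\<lambda>x y. {s \<in> space M. X s \<le> x \<and> Y s \<le> y}"
  let ?x = "real a / N" and ?x' = "real (Suc a) / N" and ?y = "real b / N" and ?y' = "real (Suc b) / N"
  have le: "?x \<le> ?x'" "?y \<le> ?y'" by (auto intro: divide_right_mono)
  have "cell_prob N (a, b) = prob ((?S ?x' ?y' - ?S ?x ?y') - (?S ?x' ?y - ?S ?x ?y))"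
    unfolding cell_prob_def using le by (intro arg_cong[of _ _ prob]) (auto simp: grid_cell_def)
  also have "\<dots> = prob (?S ?x' ?y' - ?S ?x ?y') - prob (?S ?x' ?y - ?S ?x ?y)"
    using le by (intro finite_measure_Diff) auto
  also have "prob (?S ?x' ?y' - ?S ?x ?y') = prob (?S ?x' ?y') - prob (?S ?x ?y')"
    using le by (intro finite_measure_Diff) auto
  also have "prob (?S ?x' ?y - ?S ?x ?y) = prob (?S ?x' ?y) - prob (?S ?x ?y)"
    using le by (intro finite_measure_Diff) auto
  finally show ?thesis unfolding cdf2_def by simp
qed

text \<open>By independence both points lie in cell r with probability p r squared, and the sum of
  these squares is at most the largest p r times the total mass, hence at most \<delta>.\<close>

lemma prob_same_cell:
  assumes Z [measurable]: "Z \<in> borel_measurable M"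
    and \<delta>: "\<And>r. r < N \<Longrightarrow> prob {s \<in> space M. Z s \<in> grid_cell N r} \<le> \<delta>" "\<delta> \<ge> 0"
    and ab: "a \<in> {1..k}" "b \<in> {1..k}" "a \<noteq> b"
  shows "measure (iid k) {p \<in> space (iid k). \<exists>r<N. Z (p a) \<in> grid_cell N r \<and> Z (p b) \<in> grid_cell N r} \<le> \<delta>"
proof -
  interpret I: prob_space "iid k" by (rule prob_space_iid)
  let ?C = "\<lambda>r. {s \<in> space M. Z s \<in> grid_cell N r}"
  have meas: "(\<lambda>p. p j) \<in> measurable (iid k) M" if "j \<in> {1..k}" for j
    using that by (intro measurable_component_singleton) auto
  note [measurable] = meas[OF ab(1)] meas[OF ab(2)]
  have "measure (iid k) {p \<in> space (iid k). \<exists>r<N. Z (p a) \<in> grid_cell N r \<and> Z (p b) \<in> grid_cell N r}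
     = measure (iid k) (\<Union>r\<in>{..<N}. {p \<in> space (iid k). Z (p a) \<in> grid_cell N r \<and> Z (p b) \<in> grid_cell N r})"
    by (intro arg_cong[of _ _ "measure (iid k)"]) auto
  also have "\<dots> \<le> (\<Sum>r<N. measure (iid k) {p \<in> space (iid k). Z (p a) \<in> grid_cell N r \<and> Z (p b) \<in> grid_cell N r})"
    by (intro I.finite_measure_subadditive_finite) (auto simp del: One_nat_def)
  also have "\<dots> = (\<Sum>r<N. prob (?C r) * prob (?C r))"
  proof (intro sum.cong refl)
    fix r
    have "{p \<in> space (iid k). Z (p a) \<in> grid_cell N r \<and> Z (p b) \<in> grid_cell N r} =
        (\<Pi>\<^sub>E j\<in>{1..k}. if j \<in> {a, b} then ?C r else space M)"
      (is "?L = ?R")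
    proof (intro set_eqI iffI)
      fix p assume "p \<in> ?L"
      then have "p \<in> extensional {1..k}" "\<forall>j\<in>{1..k}. p j \<in> space M"
        "Z (p a) \<in> grid_cell N r" "Z (p b) \<in> grid_cell N r"
        unfolding space_PiM PiE_iff by blast+
      then show "p \<in> ?R" unfolding PiE_iff by simp
    next
      fix p assume "p \<in> ?R"
      then have *: "p j \<in> (if j \<in> {a, b} then ?C r else space M)" if "j \<in> {1..k}" for j
        using that unfolding PiE_iff by blast
      have "p \<in> space (iid k)"
      proof -
        have "p j \<in> space M" if "j \<in> {1..k}" for j using *[OF that] by (auto split: if_splits)
        then show ?thesis using \<open>p \<in> ?R\<close> unfolding space_PiM PiE_iff by blast
      qed
      then show "p \<in> ?L" using *[OF ab(1)] *[OF ab(2)] by auto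
    qed
    then have "measure (iid k) {p \<in> space (iid k). Z (p a) \<in> grid_cell N r \<and> Z (p b) \<in> grid_cell N r} =
        (\<Prod>j\<in>{1..k}. prob (if j \<in> {a, b} then ?C r else space M))"
      by (simp only:) (intro measure_iid_box, auto)
    also have "\<dots> = (\<Prod>j\<in>{a, b}. prob (?C r))"
      using ab by (intro prod.mono_neutral_cong_right) (auto simp: prob_space)
    also have "\<dots> = prob (?C r) * prob (?C r)" using ab by simp
    finally show "measure (iid k) {p \<in> space (iid k). Z (p a) \<in> grid_cell N r \<and> Z (p b) \<in> grid_cell N r} =
      prob (?C r) * prob (?C r)" .
  qed
  also have "\<dots> \<le> (\<Sum>r<N. \<delta> * prob (?C r))"
    using \<delta> by (intro sum_mono mult_right_mono) auto
  also have "\<dots> = \<delta> * prob (\<Union>r<N. ?C r)"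
    unfolding sum_distrib_left[symmetric]
    by (subst finite_measure_finite_Union) (auto simp: disjoint_family_on_def dest: grid_cell_disjoint)
  also have "\<dots> \<le> \<delta>" using \<delta>(2) by (intro mult_left_le) auto
  finally show ?thesis .
qed

text \<open>Taken over ordered pairs of labels, so it is a union of at most k^2 events, each bounded
  by \<open>prob_same_cell\<close>.\<close>

definition collision :: "nat \<Rightarrow> nat \<Rightarrow> ('s \<Rightarrow> real) \<Rightarrow> (nat \<Rightarrow> 's) set" where
  "collision k N Z = (\<Union>(a, b) \<in> {(a, b). a \<in> {1..k} \<and> b \<in> {1..k} \<and> a \<noteq> b}.
     {p \<in> space (iid k). \<exists>r<N. Z (p a) \<in> grid_cell N r \<and> Z (p b) \<in> grid_cell N r})"

lemma collision_sets:
  assumes [measurable]: "Z \<in> borel_measurable M"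
  shows "collision k N Z \<in> sets (iid k)"
proof -
  have meas: "(\<lambda>p. p j) \<in> measurable (iid k) M" if "j \<in> {1..k}" for j
    using that by (intro measurable_component_singleton) auto
  show ?thesis unfolding collision_def
  proof (intro sets.finite_UN)
    show "finite {(a, b). a \<in> {1..k} \<and> b \<in> {1..k} \<and> a \<noteq> b}"
      by (rule finite_subset[of _ "{1..k} \<times> {1..k}"]) auto
  next
    fix ab assume "ab \<in> {(a, b). a \<in> {1..k} \<and> b \<in> {1..k} \<and> a \<noteq> b}"
    then obtain a b where ab: "ab = (a, b)" "a \<in> {1..k}" "b \<in> {1..k}" by blast
    note [measurable] = meas[OF ab(2)] meas[OF ab(3)]
    show "(case ab of (a, b) \<Rightarrow> {p \<in> space (iid k). \<exists>r<N. Z (p a) \<in> grid_cell N r \<and> Z (p b) \<in> grid_cell N r})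
        \<in> sets (iid k)"
      unfolding ab(1) prod.case by measurable
  qed
qed

lemma prob_collision:
  assumes Z [measurable]: "Z \<in> borel_measurable M"
    and \<delta>: "\<And>r. r < N \<Longrightarrow> prob {s \<in> space M. Z s \<in> grid_cell N r} \<le> \<delta>" "\<delta> \<ge> 0"
  shows "measure (iid k) (collision k N Z) \<le> real (k^2) * \<delta>"
proof -
  interpret I: prob_space "iid k" by (rule prob_space_iid)
  let ?P = "{(a, b). a \<in> {1..k} \<and> b \<in> {1..k} \<and> a \<noteq> b}"
  have fin: "finite ?P" by (rule finite_subset[of _ "{1..k} \<times> {1..k}"]) auto
  have card: "card ?P \<le> k^2"
  proof -
    have "card ?P \<le> card ({1..k} \<times> {1..k})" by (intro card_mono) auto
    then show ?thesis by (simp add: card_cartesian_product power2_eq_square)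
  qed
  have [measurable]: "(\<lambda>p. p j) \<in> measurable (iid k) M" if "j \<in> {1..k}" for j
    using that by (intro measurable_component_singleton) auto
  have "measure (iid k) (collision k N Z) \<le> (\<Sum>(a,b)\<in>?P. measure (iid k)
      {p \<in> space (iid k). \<exists>r<N. Z (p a) \<in> grid_cell N r \<and> Z (p b) \<in> grid_cell N r})"
    unfolding collision_def case_prod_unfold
    using fin by (intro I.finite_measure_subadditive_finite)
      (auto simp del: atLeastAtMost_iff One_nat_def simp: case_prod_unfold)
  also have "\<dots> \<le> (\<Sum>(a,b)\<in>?P. \<delta>)"
    using prob_same_cell[OF Z \<delta>] by (intro sum_mono) (auto simp del: atLeastAtMost_iff)
  also have "\<dots> = real (card ?P) * \<delta>" by (simp add: case_prod_unfold)
  also have "\<dots> \<le> real (k^2) * \<delta>" using card \<delta>(2) by (intro mult_right_mono) (simp_all only: of_nat_le_iff)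
  finally show ?thesis .
qed

text \<open>The boxes given by \<open>pattern_cells\<close> are disjoint and contained in the event.
  Conversely, almost every tuple of the event outside all boxes has two points in a common column or
  a common row. Each of these two collision events costs k^2 \<delta>, whence the factor 2.\<close>

lemma ordered_pattern_approx:
  assumes inj: "inj_on \<tau> {1..k}" and N: "N > 0"
    and \<delta>: "\<And>r. r < N \<Longrightarrow> prob {s \<in> space M. X s \<in> grid_cell N r} \<le> \<delta>"
      "\<And>r. r < N \<Longrightarrow> prob {s \<in> space M. Y s \<in> grid_cell N r} \<le> \<delta>" "\<delta> \<ge> 0"
  shows "\<bar>measure (iid k) (ordered_pattern k \<tau>) -
     (\<Sum>c\<in>pattern_cells k \<tau> N. \<Prod>j\<in>{1..k}. cell_prob N (c j))\<bar> \<le> 2 * real (k^2) * \<delta>"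
proof -
  interpret I: prob_space "iid k" by (rule prob_space_iid)
  interpret PP: product_prob_space "\<lambda>_::nat. M" "{1..k}" by unfold_locales
  define B where "B c = (\<Pi>\<^sub>E j\<in>{1..k}. {s \<in> space M. X s \<in> grid_cell N (fst (c j)) \<and>
     Y s \<in> grid_cell N (snd (c j))})" for c :: "nat \<Rightarrow> nat \<times> nat"
  define U where "U = (\<Union>c\<in>pattern_cells k \<tau> N. B c)"
  let ?E = "ordered_pattern k \<tau>" and ?G = "pattern_cells k \<tau> N"
  have B_sets: "B c \<in> sets (iid k)" for c
    unfolding B_def by (intro sets_PiM_I_finite) auto
  have U_sets: "U \<in> sets (iid k)" 
    unfolding U_def using finite_pattern_cells B_sets by blast
  have disj: "disjoint_family_on B ?G"
    unfolding disjoint_family_on_def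
  proof (intro ballI impI)
    fix c d assume cd: "c \<in> ?G" "d \<in> ?G" "c \<noteq> d"
    then obtain j where j: "j \<in> {1..k}" "c j \<noteq> d j"
      unfolding pattern_cells_def by (metis (no_types, lifting) PiE_ext mem_Collect_eq)
    show "B c \<inter> B d = {}"
    proof (rule ccontr)
      assume "B c \<inter> B d \<noteq> {}"
      then obtain p where "p \<in> B c" "p \<in> B d" by auto
      then have "X (p j) \<in> grid_cell N (fst (c j))" "X (p j) \<in> grid_cell N (fst (d j))"
        "Y (p j) \<in> grid_cell N (snd (c j))" "Y (p j) \<in> grid_cell N (snd (d j))"
        using j(1) unfolding B_def by (auto simp: PiE_iff)
      then show False using j(2) grid_cell_disjoint by (metis prod_eqI)
    qed
  qed
  have "measure (iid k) U = (\<Sum>c\<in>?G. measure (iid k) (B c))"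
    unfolding U_def using B_sets by (intro I.finite_measure_finite_Union finite_pattern_cells disj) auto
  also have "\<dots> = (\<Sum>c\<in>?G. \<Prod>j\<in>{1..k}. cell_prob N (c j))"
    unfolding B_def cell_prob_def by (intro sum.cong refl measure_iid_box) auto
  finally have mU: "measure (iid k) U = (\<Sum>c\<in>?G. \<Prod>j\<in>{1..k}. cell_prob N (c j))" .
  have sub: "U \<subseteq> ?E"
  proof
    fix p assume "p \<in> U"
    then obtain c where c: "c \<in> ?G" "p \<in> B c" unfolding U_def by auto
    have cell: "X (p j) \<in> grid_cell N (fst (c j))" "Y (p j) \<in> grid_cell N (snd (c j))" if "j \<in> {1..k}" for j
      using c(2) that unfolding B_def by (auto simp: PiE_iff)
    have "p \<in> space (iid k)" using c(2) B_sets sets.sets_into_space by blast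
    moreover have "X (p a) < X (p b)" if ab: "a \<in> {1..k}" "b \<in> {1..k}" "a < b" for a b
    proof -
      have "fst (c a) < fst (c b)" using c(1) ab unfolding pattern_cells_def by blast
      from grid_cell_less[OF cell(1)[OF ab(1)] cell(1)[OF ab(2)] this] show ?thesis .
    qed
    moreover have lt: "Y (p a) < Y (p b)" if ab: "a \<in> {1..k}" "b \<in> {1..k}" "\<tau> a < \<tau> b" for a b
    proof -
      have "snd (c a) < snd (c b)" using c(1) ab unfolding pattern_cells_def by blast
      from grid_cell_less[OF cell(2)[OF ab(1)] cell(2)[OF ab(2)] this] show ?thesis .
    qed
    \<comment> \<open>Injectivity of \<tau> supplies the converse: a and b differ, and the
      alternative \<tau> b < \<tau> a would reverse the order of the Y values.\<close>
    moreover have "\<tau> a < \<tau> b" if "a \<in> {1..k}" "b \<in> {1..k}" "Y (p a) < Y (p b)" for a b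
      using that lt[of b a] inj by (metis inj_on_def less_asym less_irrefl nat_neq_iff)
    ultimately show "p \<in> ?E" unfolding ordered_pattern_def by blast
  qed
  have AE: "AE p in iid k. p \<in> ?E \<longrightarrow> p \<in> U \<union> (collision k N X \<union> collision k N Y)"
  proof -
    have "AE p in iid k. \<forall>j\<in>{1..k}. X (p j) \<in> {0<..1} \<and> Y (p j) \<in> {0<..1}"
      using AE_X AE_Y by (intro AE_finite_allI PP.AE_component) auto
    then show ?thesis
    proof eventually_elim
      case (elim p)
      show ?case
      proof
        assume p: "p \<in> ?E"
        define c where "c = (\<lambda>j\<in>{1..k}. (cell_index N (X (p j)), cell_index N (Y (p j))))"
        have sp: "p \<in> space (iid k)" using p by (simp add: ordered_pattern_def)
        have cell: "fst (c j) < N" "X (p j) \<in> grid_cell N (fst (c j))"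
            "snd (c j) < N" "Y (p j) \<in> grid_cell N (snd (c j))" if "j \<in> {1..k}" for j
          using cell_index_props[OF N] elim that unfolding c_def by auto
        have pB: "p \<in> B c" using sp cell unfolding B_def space_PiM by (auto simp: PiE_iff)
        show "p \<in> U \<union> (collision k N X \<union> collision k N Y)"
        proof (rule ccontr)
          assume "p \<notin> U \<union> (collision k N X \<union> collision k N Y)"
          then have nU: "p \<notin> U" and nX: "p \<notin> collision k N X" and nY: "p \<notin> collision k N Y" by auto
          \<comment> \<open>Monotonicity of \<open>cell_index\<close> gives only weak inequalities
            between cell numbers; the absence of collisions makes them strict.\<close>
          have neq: "fst (c a) \<noteq> fst (c b)" "snd (c a) \<noteq> snd (c b)"
            if ab: "a \<in> {1..k}" "b \<in> {1..k}" "a \<noteq> b" for a b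
          proof -
            show "fst (c a) \<noteq> fst (c b)"
            proof
              assume "fst (c a) = fst (c b)"
              then have "\<exists>r<N. X (p a) \<in> grid_cell N r \<and> X (p b) \<in> grid_cell N r"
                using cell[OF ab(1)] cell[OF ab(2)] by auto
              then show False using nX ab sp unfolding collision_def by blast
            qed
            show "snd (c a) \<noteq> snd (c b)"
            proof
              assume "snd (c a) = snd (c b)"
              then have "\<exists>r<N. Y (p a) \<in> grid_cell N r \<and> Y (p b) \<in> grid_cell N r"
                using cell[OF ab(1)] cell[OF ab(2)] by auto
              then show False using nY ab sp unfolding collision_def by blast
            qed
          qed
          have "c \<in> ?G"
            unfolding pattern_cells_def
          proof (intro CollectI conjI ballI)
            show "c \<in> {1..k} \<rightarrow>\<^sub>E {..<N} \<times> {..<N}"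
              using cell unfolding c_def by (auto simp: PiE_iff)
          next
            fix a b assume ab: "a \<in> {1..k}" "b \<in> {1..k}"
            show "a < b \<longrightarrow> fst (c a) < fst (c b)"
            proof
              assume "a < b"
              then have "X (p a) < X (p b)" using p ab unfolding ordered_pattern_def by auto
              then have "fst (c a) \<le> fst (c b)" using ab cell_index_mono unfolding c_def by auto
              then show "fst (c a) < fst (c b)" using neq(1)[OF ab] \<open>a < b\<close> by auto
            qed
            have "Y (p a) < Y (p b) \<longleftrightarrow> snd (c a) < snd (c b)"
            proof
              assume *: "Y (p a) < Y (p b)"
              then have "snd (c a) \<le> snd (c b)" using ab cell_index_mono unfolding c_def by auto
              then show "snd (c a) < snd (c b)" using neq(2)[OF ab] * by (cases "a = b") auto
            next
              assume "snd (c a) < snd (c b)"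
              then show "Y (p a) < Y (p b)" using grid_cell_less[OF cell(4)[OF ab(1)] cell(4)[OF ab(2)]] by simp
            qed
            then show "snd (c a) < snd (c b) \<longleftrightarrow> \<tau> a < \<tau> b"
              using p ab unfolding ordered_pattern_def by auto
          qed
          then show False using pB nU unfolding U_def by auto
        qed
      qed
    qed
  qed
  have col_sets: "collision k N X \<in> sets (iid k)" "collision k N Y \<in> sets (iid k)"
    by (intro collision_sets; simp)+
  have "measure (iid k) ?E \<le> measure (iid k) (U \<union> (collision k N X \<union> collision k N Y))"
    using AE U_sets col_sets by (intro I.finite_measure_mono_AE) auto
  also have "\<dots> \<le> measure (iid k) U + (measure (iid k) (collision k N X) + measure (iid k) (collision k N Y))"
    using U_sets col_sets
    by (intro order.trans[OF measure_Un_le] add_left_mono measure_Un_le) auto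
  also have "\<dots> \<le> measure (iid k) U + (real (k^2) * \<delta> + real (k^2) * \<delta>)"
    using prob_collision[OF measurable_X \<delta>(1,3)] prob_collision[OF measurable_Y \<delta>(2,3)]
    by (intro add_mono) auto
  finally have "measure (iid k) ?E \<le> measure (iid k) U + 2 * real (k^2) * \<delta>" by (simp add: algebra_simps)
  moreover have "measure (iid k) U \<le> measure (iid k) ?E"
    using sub ordered_pattern_sets by (intro I.finite_measure_mono)
  ultimately show ?thesis unfolding mU by simp
qed

end

subsection \<open>Ranks and ordered patterns\<close>

lemma rank_in_less_iff:
  assumes "finite A" "l \<in> A" "j \<in> A"
  shows "rank_in A f l < rank_in A f j \<longleftrightarrow> f l < f j"
proof
  assume "f l < f j"
  then have "{i \<in> A. f i \<le> f l} \<subset> {i \<in> A. f i \<le> f j}"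
    using assms by (intro psubsetI) (auto simp: set_eq_iff not_le intro: exI[of _ j])
  then show "rank_in A f l < rank_in A f j"
    unfolding rank_in_def using assms by (intro psubset_card_mono) auto
next
  assume *: "rank_in A f l < rank_in A f j"
  show "f l < f j"
  proof (rule ccontr)
    assume "\<not> f l < f j"
    then have "{i \<in> A. f i \<le> f j} \<subseteq> {i \<in> A. f i \<le> f l}" by auto
    then have "rank_in A f j \<le> rank_in A f l"
      unfolding rank_in_def using assms by (intro card_mono) auto
    with * show False by simp
  qed
qed

lemma rank_in_bij:
  assumes "inj_on f {1..k}"
  shows "bij_betw (rank_in {1..k} f) {1..k} {1..k}"
proof -
  have inj: "inj_on (rank_in {1..k} f) {1..k}"
  proof (rule inj_onI)
    fix i j assume ij: "i \<in> {1..k}" "j \<in> {1..k}" "rank_in {1..k} f i = rank_in {1..k} f j"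
    then have "\<not> f i < f j" "\<not> f j < f i"
      using rank_in_less_iff[of "{1..k}" i j f] rank_in_less_iff[of "{1..k}" j i f] by simp_all
    then have "f i = f j" by linarith
    then show "i = j" using inj_onD[OF assms] ij(1,2) by blast
  qed
  have "rank_in {1..k} f j \<in> {1..k}" if j: "j \<in> {1..k}" for j
  proof -
    have "card {j} \<le> rank_in {1..k} f j" unfolding rank_in_def using j by (intro card_mono) auto
    moreover have "rank_in {1..k} f j \<le> card {1..k}" unfolding rank_in_def by (intro card_mono) auto
    ultimately show ?thesis by simp
  qed
  then have "rank_in {1..k} f ` {1..k} = {1..k}"
    using inj by (intro endo_inj_surj) auto
  then show ?thesis using inj by (simp add: bij_betw_def)
qed

lemma rank_in_permutes:
  assumes "\<pi> permutes {1..k}"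
  shows "rank_in {1..k} f (\<pi> a) = card {b \<in> {1..k}. f (\<pi> b) \<le> f (\<pi> a)}"
proof -
  have "{l \<in> {1..k}. f l \<le> f (\<pi> a)} = \<pi> ` {b \<in> {1..k}. f (\<pi> b) \<le> f (\<pi> a)}" (is "?L = ?R")
  proof
    show "?R \<subseteq> ?L" using permutes_in_image[OF assms] by blast
    show "?L \<subseteq> ?R"
    proof
      fix l assume l: "l \<in> ?L"
      then obtain b where "b \<in> {1..k}" "l = \<pi> b" using permutes_image[OF assms] by blast
      then show "l \<in> ?R" using l by blast
    qed
  qed
  then show ?thesis
    unfolding rank_in_def using permutes_inj_on[OF assms] by (simp add: card_image)
qed

lemma card_permutes_le:
  assumes "\<tau> permutes {1..k}" "a \<in> {1..k}"
  shows "card {b \<in> {1..k}. \<tau> b \<le> \<tau> a} = \<tau> a"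
proof -
  have ta: "\<tau> a \<in> {1..k}" using permutes_in_image[OF assms(1)] assms(2) by blast
  have "\<tau> ` {b \<in> {1..k}. \<tau> b \<le> \<tau> a} = {1..\<tau> a}" (is "?L = ?R")
  proof
    show "?L \<subseteq> ?R"
    proof
      fix c assume "c \<in> ?L"
      then obtain b where b: "b \<in> {1..k}" "\<tau> b \<le> \<tau> a" "c = \<tau> b" by blast
      then have "\<tau> b \<in> {1..k}" using permutes_in_image[OF assms(1)] by blast
      then show "c \<in> ?R" using b by auto
    qed
    show "?R \<subseteq> ?L"
    proof
      fix c assume c: "c \<in> ?R"
      then have "c \<in> {1..k}" using ta by auto
      then obtain b where "b \<in> {1..k}" "c = \<tau> b" using permutes_image[OF assms(1)] by blast
      then show "c \<in> ?L" using c by auto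
    qed
  qed
  then have "card (\<tau> ` {b \<in> {1..k}. \<tau> b \<le> \<tau> a}) = \<tau> a" by simp
  then show ?thesis using permutes_inj_on[OF assms(1)] by (simp add: card_image)
qed

text \<open>Here \<pi> lists the labels by increasing x, and the y values read along this list show
  the pattern \<tau>. It is the relabelling that turns a sample with pattern \<tau> into an ordered
  one.\<close>

definition sorts_pattern ::
    "nat \<Rightarrow> (nat \<Rightarrow> nat) \<Rightarrow> (nat \<Rightarrow> real) \<Rightarrow> (nat \<Rightarrow> real) \<Rightarrow> (nat \<Rightarrow> nat) \<Rightarrow> bool" where
  "sorts_pattern k \<tau> x y \<pi> \<longleftrightarrow> (\<forall>a\<in>{1..k}. \<forall>b\<in>{1..k}.
     (a < b \<longrightarrow> x (\<pi> a) < x (\<pi> b)) \<and> (y (\<pi> a) < y (\<pi> b) \<longleftrightarrow> \<tau> a < \<tau> b))"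

lemma sorts_pattern_ranks:
  assumes "\<pi> permutes {1..k}" "\<tau> permutes {1..k}" "sorts_pattern k \<tau> x y \<pi>" "a \<in> {1..k}"
  shows "rank_in {1..k} x (\<pi> a) = a" "rank_in {1..k} y (\<pi> a) = \<tau> a"
proof -
  have le: "x (\<pi> b) \<le> x (\<pi> a) \<longleftrightarrow> b \<le> a" "y (\<pi> b) \<le> y (\<pi> a) \<longleftrightarrow> \<tau> b \<le> \<tau> a" if "b \<in> {1..k}" for b
  proof -
    have "(b < a \<longrightarrow> x (\<pi> b) < x (\<pi> a)) \<and> (a < b \<longrightarrow> x (\<pi> a) < x (\<pi> b))"
      and *: "y (\<pi> a) < y (\<pi> b) \<longleftrightarrow> \<tau> a < \<tau> b"
      using assms(3,4) that unfolding sorts_pattern_def by blast+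
    then show "x (\<pi> b) \<le> x (\<pi> a) \<longleftrightarrow> b \<le> a" by (cases b a rule: linorder_cases) auto
    show "y (\<pi> b) \<le> y (\<pi> a) \<longleftrightarrow> \<tau> b \<le> \<tau> a" using * by (simp add: not_less[symmetric])
  qed
  have "rank_in {1..k} x (\<pi> a) = card {b \<in> {1..k}. b \<le> a}"
    unfolding rank_in_permutes[OF assms(1)] using le by (intro arg_cong[of _ _ card]) blast
  also have "{b \<in> {1..k}. b \<le> a} = {1..a}" using assms(4) by auto
  finally show "rank_in {1..k} x (\<pi> a) = a" by simp
  have "rank_in {1..k} y (\<pi> a) = card {b \<in> {1..k}. \<tau> b \<le> \<tau> a}"
    unfolding rank_in_permutes[OF assms(1)] using le by (intro arg_cong[of _ _ card]) blast
  then show "rank_in {1..k} y (\<pi> a) = \<tau> a" using card_permutes_le[OF assms(2,4)] by simp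
qed

text \<open>A sorting permutation is inverse to the ranking of the x values. Uniqueness makes the k!
  relabelled events disjoint.\<close>

lemma sorts_pattern_unique:
  assumes "\<pi> permutes {1..k}" "\<pi>' permutes {1..k}" "\<tau> permutes {1..k}"
    "sorts_pattern k \<tau> x y \<pi>" "sorts_pattern k \<tau> x y \<pi>'"
  shows "\<pi> = \<pi>'"
proof
  fix a show "\<pi> a = \<pi>' a"
  proof (cases "a \<in> {1..k}")
    case True
    have mem: "\<pi> a \<in> {1..k}" using permutes_in_image[OF assms(1)] True by blast
    then obtain b where b: "b \<in> {1..k}" "\<pi> a = \<pi>' b" using permutes_image[OF assms(2)] by blast
    have "a = b"
      using sorts_pattern_ranks(1)[OF assms(1,3,4) True] sorts_pattern_ranks(1)[OF assms(2,3,5) b(1)] b(2)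
      by simp
    then show ?thesis using b by simp
  qed (use assms in \<open>simp add: permutes_not_in\<close>)
qed

text \<open>Without ties the ranking of x is a bijection of {1..k}; its inverse, extended by the
  identity, is the sorting permutation. Conversely, along a sorting permutation the x rank of the
  a-th point is a and its y rank is \<tau> a.\<close>

lemma sorts_pattern_iff:
  assumes "\<tau> permutes {1..k}" "inj_on x {1..k}"
  shows "(\<forall>a\<in>{1..k}. \<forall>j\<in>{1..k}. rank_in {1..k} x j = a \<longrightarrow> rank_in {1..k} y j = \<tau> a) \<longleftrightarrow>
    (\<exists>\<pi>. \<pi> permutes {1..k} \<and> sorts_pattern k \<tau> x y \<pi>)"
proof
  assume E: "\<forall>a\<in>{1..k}. \<forall>j\<in>{1..k}. rank_in {1..k} x j = a \<longrightarrow> rank_in {1..k} y j = \<tau> a"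
  let ?r = "rank_in {1..k} x"
  have bij: "bij_betw ?r {1..k} {1..k}" by (rule rank_in_bij[OF assms(2)])
  define \<pi> where "\<pi> j = (if j \<in> {1..k} then inv_into {1..k} ?r j else j)" for j
  have perm: "\<pi> permutes {1..k}"
  proof (rule bij_imp_permutes)
    show "bij_betw \<pi> {1..k} {1..k}"
      using bij_betw_inv_into[OF bij] by (subst bij_betw_cong[of _ \<pi> "inv_into {1..k} ?r"]) (auto simp: \<pi>_def)
  qed (simp only: \<pi>_def if_False)
  have r\<pi>: "?r (\<pi> a) = a" if "a \<in> {1..k}" for a
    using that bij by (simp add: \<pi>_def bij_betw_def f_inv_into_f)
  have mem: "\<pi> a \<in> {1..k}" if "a \<in> {1..k}" for a using permutes_in_image[OF perm] that by blast
  have "sorts_pattern k \<tau> x y \<pi>"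
    unfolding sorts_pattern_def
  proof (intro ballI conjI)
    fix a b assume ab: "a \<in> {1..k}" "b \<in> {1..k}"
    show "a < b \<longrightarrow> x (\<pi> a) < x (\<pi> b)"
      using rank_in_less_iff[OF _ mem[OF ab(1)] mem[OF ab(2)], of x] r\<pi> ab by simp
    have "rank_in {1..k} y (\<pi> a) = \<tau> a" "rank_in {1..k} y (\<pi> b) = \<tau> b"
      using E mem ab r\<pi> by blast+
    then show "y (\<pi> a) < y (\<pi> b) \<longleftrightarrow> \<tau> a < \<tau> b"
      using rank_in_less_iff[OF _ mem[OF ab(1)] mem[OF ab(2)], of y] by simp
  qed
  then show "\<exists>\<pi>. \<pi> permutes {1..k} \<and> sorts_pattern k \<tau> x y \<pi>" using perm by blast
next
  assume "\<exists>\<pi>. \<pi> permutes {1..k} \<and> sorts_pattern k \<tau> x y \<pi>"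
  then obtain \<pi> where \<pi>: "\<pi> permutes {1..k}" "sorts_pattern k \<tau> x y \<pi>" by blast
  show "\<forall>a\<in>{1..k}. \<forall>j\<in>{1..k}. rank_in {1..k} x j = a \<longrightarrow> rank_in {1..k} y j = \<tau> a"
  proof (intro ballI impI)
    fix a j assume a: "a \<in> {1..k}" and j: "j \<in> {1..k}" and r: "rank_in {1..k} x j = a"
    obtain b where b: "b \<in> {1..k}" "j = \<pi> b" using permutes_image[OF \<pi>(1)] j by blast
    show "rank_in {1..k} y j = \<tau> a"
      using sorts_pattern_ranks[OF \<pi>(1) assms(1) \<pi>(2) b(1)] b r by simp
  qed
qed

section \<open>Ties and the symmetry of the sample under relabelling\<close>

context square_point
begin

lemma rank_in_measurable:
  assumes [measurable]: "Z \<in> borel_measurable M" and j: "j \<in> {1..k}"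
  shows "(\<lambda>p. rank_in {1..k} (\<lambda>l. Z (p l)) j) \<in> measurable (iid k) (count_space UNIV)"
proof -
  have meas: "(\<lambda>p. p j) \<in> measurable (iid k) M" if "j \<in> {1..k}" for j
    using that by (intro measurable_component_singleton) auto
  have eq: "rank_in {1..k} (\<lambda>l. Z (p l)) j = (\<Sum>l\<in>{1..k}. if Z (p l) \<le> Z (p j) then 1 else 0)" for p
    unfolding rank_in_def by (simp add: sum.If_cases Int_def conj_commute)
  note [measurable] = meas[OF j]
  have "(\<lambda>p. if Z (p l) \<le> Z (p j) then 1 else 0::nat) \<in> measurable (iid k) (count_space UNIV)"
    if "l \<in> {1..k}" for l
  proof -
    note [measurable] = meas[OF that]
    show ?thesis by measurable
  qed
  then show ?thesis unfolding eq by (intro measurable_sum_nat)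
qed

definition rank_pattern :: "nat \<Rightarrow> (nat \<Rightarrow> nat) \<Rightarrow> (nat \<Rightarrow> 's) set" where
  "rank_pattern k \<tau> = {p \<in> space (iid k). \<forall>a\<in>{1..k}. \<forall>j\<in>{1..k}.
     rank_in {1..k} (\<lambda>l. X (p l)) j = a \<longrightarrow> rank_in {1..k} (\<lambda>l. Y (p l)) j = \<tau> a}"

lemma rank_pattern_sets: "rank_pattern k \<tau> \<in> sets (iid k)"
  unfolding rank_pattern_def
proof (intro sets.sets_Collect_finite_All)
  fix a j assume j: "j \<in> {1..k}"
  note [measurable] = rank_in_measurable[OF measurable_X j] rank_in_measurable[OF measurable_Y j]
  show "{p \<in> space (iid k). rank_in {1..k} (\<lambda>l. X (p l)) j = a \<longrightarrow>
      rank_in {1..k} (\<lambda>l. Y (p l)) j = \<tau> a} \<in> sets (iid k)"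
    by measurable
qed auto

text \<open>Tied points share a cell of every grid, and for the grid of mesh 1 / N this has
  probability at most 1 / N.\<close>

lemma AE_no_ties:
  assumes small: "\<And>N r. N > 0 \<Longrightarrow> r < N \<Longrightarrow> prob {s \<in> space M. X s \<in> grid_cell N r} \<le> 1 / real N"
  shows "AE p in iid k. inj_on (\<lambda>l. X (p l)) {1..k}"
proof -
  interpret I: prob_space "iid k" by (rule prob_space_iid)
  interpret PP: product_prob_space "\<lambda>_::nat. M" "{1..k}" by unfold_locales
  have meas: "(\<lambda>p. p j) \<in> measurable (iid k) M" if "j \<in> {1..k}" for j
    using that by (intro measurable_component_singleton) auto
  have unit: "AE p in iid k. \<forall>j\<in>{1..k}. X (p j) \<in> {0<..1}"
    using AE_X by (intro AE_finite_allI PP.AE_component) auto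
  have "AE p in iid k. X (p a) \<noteq> X (p b)" if ab: "a \<in> {1..k}" "b \<in> {1..k}" "a \<noteq> b" for a b
  proof -
    note [measurable] = meas[OF ab(1)] meas[OF ab(2)]
    let ?T = "{p \<in> space (iid k). X (p a) = X (p b)}"
    have le: "I.prob ?T \<le> 1 / real N" if N: "N > 0" for N
    proof -
      have "I.prob ?T \<le> I.prob {p \<in> space (iid k). \<exists>r<N. X (p a) \<in> grid_cell N r \<and> X (p b) \<in> grid_cell N r}"
      proof (rule I.finite_measure_mono_AE)
        show "AE p in iid k. p \<in> ?T \<longrightarrow>
            p \<in> {p \<in> space (iid k). \<exists>r<N. X (p a) \<in> grid_cell N r \<and> X (p b) \<in> grid_cell N r}"
          using unit
        proof eventually_elim
          case (elim p)
          show ?case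
            using cell_index_props[OF N, of "X (p a)"] elim ab by fastforce
        qed
      qed measurable
      also have "\<dots> \<le> 1 / real N" using small N ab by (intro prob_same_cell) auto
      finally show ?thesis .
    qed
    have "I.prob ?T \<le> 0"
    proof (rule LIMSEQ_le_const)
      show "(\<lambda>N. 1 / real (Suc N)) \<longlonglongrightarrow> 0" by (rule LIMSEQ_Suc, rule lim_1_over_n)
      show "\<exists>N. \<forall>n\<ge>N. I.prob ?T \<le> 1 / real (Suc n)" using le[OF zero_less_Suc] by blast
    qed
    then have "I.prob ?T = 0" by (simp add: measure_le_0_iff)
    then have "emeasure (iid k) ?T = 0" unfolding I.emeasure_eq_measure by (simp only: ennreal_0)
    moreover have "?T \<in> sets (iid k)" by measurable
    ultimately have "?T \<in> null_sets (iid k)" by (rule null_setsI)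
    then show ?thesis by (rule AE_I') auto
  qed
  then have "AE p in iid k. \<forall>a\<in>{1..k}. \<forall>b\<in>{1..k}. a \<noteq> b \<longrightarrow> X (p a) \<noteq> X (p b)"
    by (intro AE_finite_allI) auto
  then show ?thesis by eventually_elim (auto simp: inj_on_def)
qed

text \<open>Up to ties the event is the disjoint union, over all permutations \<pi>, of the events
  that the sample relabelled by \<pi> is ordered. Relabelling preserves the product measure, so
  these k! events are equally likely.\<close>

lemma measure_rank_pattern:
  assumes \<tau>: "\<tau> permutes {1..k}"
    and small: "\<And>N r. N > 0 \<Longrightarrow> r < N \<Longrightarrow> prob {s \<in> space M. X s \<in> grid_cell N r} \<le> 1 / real N"
  shows "measure (iid k) (rank_pattern k \<tau>) = fact k * measure (iid k) (ordered_pattern k \<tau>)"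
proof -
  interpret I: prob_space "iid k" by (rule prob_space_iid)
  define R where "R \<pi> p = (\<lambda>j\<in>{1..k}. p (\<pi> j))" for \<pi> :: "nat \<Rightarrow> nat" and p :: "nat \<Rightarrow> 's"
  define S where "S \<pi> = R \<pi> -` ordered_pattern k \<tau> \<inter> space (iid k)" for \<pi>
  let ?P = "{\<pi>. \<pi> permutes {1..k}}"
  have reindex: "distr (iid k) (iid k) (R \<pi>) = iid k" if "\<pi> permutes {1..k}" for \<pi>
    unfolding R_def
    using permutes_inj_on[OF that] permutes_in_image[OF that] prob_space_axioms
    by (intro distr_PiM_reindex) auto
  have R_meas: "R \<pi> \<in> measurable (iid k) (iid k)" if "\<pi> permutes {1..k}" for \<pi>
    unfolding R_def using permutes_in_image[OF that]
    by (intro measurable_restrict measurable_component_singleton) auto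
  have S_sets: "S \<pi> \<in> sets (iid k)" if "\<pi> permutes {1..k}" for \<pi>
    unfolding S_def by (rule measurable_sets[OF R_meas[OF that] ordered_pattern_sets])
  have S_iff: "p \<in> S \<pi> \<longleftrightarrow> p \<in> space (iid k) \<and> sorts_pattern k \<tau> (\<lambda>l. X (p l)) (\<lambda>l. Y (p l)) \<pi>"
    if "\<pi> permutes {1..k}" for p \<pi>
    using measurable_space[OF R_meas[OF that]]
    by (auto simp: S_def ordered_pattern_def sorts_pattern_def R_def simp del: atLeastAtMost_iff)
  have mS: "I.prob (S \<pi>) = I.prob (ordered_pattern k \<tau>)" if "\<pi> permutes {1..k}" for \<pi>
  proof -
    have "I.prob (ordered_pattern k \<tau>) = measure (distr (iid k) (iid k) (R \<pi>)) (ordered_pattern k \<tau>)"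
      by (simp only: reindex[OF that])
    also have "\<dots> = I.prob (S \<pi>)"
      unfolding S_def by (rule measure_distr[OF R_meas[OF that] ordered_pattern_sets])
    finally show ?thesis ..
  qed
  have fin: "finite ?P" by (rule finite_permutations) auto
  have no_ties: "AE p in iid k. inj_on (\<lambda>l. X (p l)) {1..k}"
    using small by (rule AE_no_ties)
  have "I.prob (rank_pattern k \<tau>) = I.prob (\<Union>\<pi>\<in>?P. S \<pi>)"
  proof (rule I.finite_measure_eq_AE)
    show "AE p in iid k. (p \<in> rank_pattern k \<tau>) = (p \<in> (\<Union>\<pi>\<in>?P. S \<pi>))"
      using no_ties AE_space
    proof eventually_elim
      case (elim p)
      show ?case
        using sorts_pattern_iff[OF \<tau> elim(1), of "\<lambda>l. Y (p l)"] elim(2) S_iff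
        unfolding rank_pattern_def by auto
    qed
    show "rank_pattern k \<tau> \<in> sets (iid k)" by (rule rank_pattern_sets)
    show "(\<Union>\<pi>\<in>?P. S \<pi>) \<in> sets (iid k)" using fin S_sets by (intro sets.finite_UN) auto
  qed
  also have "\<dots> = (\<Sum>\<pi>\<in>?P. I.prob (S \<pi>))"
  proof (rule I.finite_measure_finite_Union[OF fin])
    show "disjoint_family_on S ?P"
      unfolding disjoint_family_on_def using S_iff sorts_pattern_unique[OF _ _ \<tau>] by blast
  qed (use S_sets in auto)
  also have "\<dots> = (\<Sum>\<pi>\<in>?P. I.prob (ordered_pattern k \<tau>))"
    using mS by (intro sum.cong) auto
  also have "\<dots> = fact k * I.prob (ordered_pattern k \<tau>)"
    using card_permutations[of "{1..k}" k] by simp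
  finally show ?thesis .
qed

end

subsection \<open>The functions u, V and the conditional tail\<close>

locale profile =
  fixes g g' :: "real \<Rightarrow> real"
  assumes dec: "strict_antimono_on {0..1} g"
    and deriv: "\<And>x. x \<in> {0..1} \<Longrightarrow> (g has_real_derivative g' x) (at x within {0..1})"
    and cont': "continuous_on {0..1} g'"
    and g0: "g 0 = 1"
    and g1: "g 1 = 0"
begin

lemma g_cont: "continuous_on {0..1} g"
  using deriv by (rule DERIV_continuous_on)

lemma g_less: "0 \<le> x \<Longrightarrow> x < y \<Longrightarrow> y \<le> 1 \<Longrightarrow> g y < g x"
  using dec by (auto simp: monotone_on_def)

lemma g_antimono: "0 \<le> x \<Longrightarrow> x \<le> y \<Longrightarrow> y \<le> 1 \<Longrightarrow> g y \<le> g x"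
  using g_less[of x y] by (cases "x = y") auto

lemma g_pos: "0 \<le> x \<Longrightarrow> x < 1 \<Longrightarrow> g x > 0"
  using g_less[of x 1] g1 by simp

lemma g_le1: "0 \<le> x \<Longrightarrow> x \<le> 1 \<Longrightarrow> g x \<le> 1"
  using g_antimono[of 0 x] g0 by simp

lemma g_nonneg: "0 \<le> x \<Longrightarrow> x \<le> 1 \<Longrightarrow> 0 \<le> g x"
  using g_antimono[of x 1] g1 by simp

text \<open>The continuous derivative is bounded on the compact interval and g 1 = 0. Hence 1 / g
  grows at least like 1 / (1 - z) near 1, which makes u diverge there.\<close>

lemma g_lipschitz_at_1:
  obtains K where "K > 0" "\<And>z. 0 \<le> z \<Longrightarrow> z \<le> 1 \<Longrightarrow> g z \<le> K * (1 - z)"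
proof -
  have "compact (g' ` {0..1})" by (intro compact_continuous_image cont') auto
  then obtain B where B: "\<And>x. x \<in> {0..1} \<Longrightarrow> norm (g' x) \<le> B"
    using compact_imp_bounded bounded_iff by (metis imageI)
  have bd: "g z \<le> (\<bar>B\<bar> + 1) * (1 - z)" if "0 \<le> z" "z \<le> 1" for z
  proof -
    have "norm (g z - g 1) \<le> (\<bar>B\<bar> + 1) * norm (z - 1)"
    proof (rule field_differentiable_bound[of "{0..1}" g g'])
      show "norm (g' x) \<le> \<bar>B\<bar> + 1" if "x \<in> {0..1}" for x using B[OF that] by simp
    qed (use that deriv in auto)
    then show ?thesis using that g1 by simp
  qed
  show ?thesis using bd by (intro that[of "\<bar>B\<bar> + 1"]) auto
qed

abbreviation "u \<equiv> u_fun g"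
abbreviation "V \<equiv> V_fun g"

lemma inv_g_cont: "b < 1 \<Longrightarrow> continuous_on {0..b} (\<lambda>z. 1 / g z)"
  using g_pos by (intro continuous_intros continuous_on_subset[OF g_cont]) (auto simp: less_imp_neq[symmetric])

lemma inv_g_integrable: "0 \<le> a \<Longrightarrow> b < 1 \<Longrightarrow> (\<lambda>z. 1 / g z) integrable_on {a..b}"
  by (intro integrable_continuous_real continuous_on_subset[OF inv_g_cont[of b]]) auto

lemma u_diff:
  assumes "0 \<le> a" "a \<le> b" "b < 1"
  shows "u b - u a = integral {a..b} (\<lambda>z. 1 / g z)"
  using Henstock_Kurzweil_Integration.integral_combine[OF assms(1,2) inv_g_integrable[of 0 b]] assms
  unfolding u_fun_def by simp

text \<open>Since g \<le> 1, the integrand 1 / g is at least 1. So u does not contract distances,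
  which is why its inverse is 1-Lipschitz.\<close>

lemma u_diff_ge:
  assumes "0 \<le> a" "a \<le> b" "b < 1"
  shows "b - a \<le> u b - u a"
proof -
  have "integral {a..b} (\<lambda>z. 1::real) \<le> integral {a..b} (\<lambda>z. 1 / g z)"
    using assms g_le1 g_pos by (intro integral_le inv_g_integrable) (auto simp: le_divide_eq_1)
  then show ?thesis using assms by (simp add: u_diff)
qed

lemma u_0 [simp]: "u 0 = 0" by (simp add: u_fun_def)

lemma u_less: "0 \<le> a \<Longrightarrow> a < b \<Longrightarrow> b < 1 \<Longrightarrow> u a < u b"
  using u_diff_ge[of a b] by simp

lemma u_less_iff: "0 \<le> a \<Longrightarrow> a < 1 \<Longrightarrow> 0 \<le> b \<Longrightarrow> b < 1 \<Longrightarrow> u a < u b \<longleftrightarrow> a < b"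
  using u_less[of a b] u_less[of b a] by (cases a b rule: linorder_cases) auto

lemma u_le_iff: "0 \<le> a \<Longrightarrow> a < 1 \<Longrightarrow> 0 \<le> b \<Longrightarrow> b < 1 \<Longrightarrow> u a \<le> u b \<longleftrightarrow> a \<le> b"
  using u_less_iff[of b a] by (simp add: not_less[symmetric])

lemma u_nonneg: "0 \<le> a \<Longrightarrow> a < 1 \<Longrightarrow> 0 \<le> u a"
  using u_diff_ge[of 0 a] by simp

lemma u_inj: "inj_on u {0..<1}"
  by (rule inj_onI) (metis atLeastLessThan_iff less_irrefl linorder_less_linear u_less)

lemma u_cont: "b < 1 \<Longrightarrow> continuous_on {0..b} u"
  unfolding u_fun_def by (intro indefinite_integral_continuous_1 inv_g_integrable) auto

lemma u_has_derivative:
  assumes "0 < x" "x < 1"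
  shows "(u has_real_derivative 1 / g x) (at x)"
proof -
  have "((\<lambda>x. integral {0..x} (\<lambda>z. 1 / g z)) has_real_derivative 1 / g x) (at x within {0..(x+1)/2})"
    using assms by (intro integral_has_real_derivative inv_g_cont) auto
  moreover have "at x within {0..(x+1)/2} = at x"
    using assms by (intro at_within_interior) (auto simp: interior_atLeastAtMost_real)
  ultimately show ?thesis unfolding u_fun_def[abs_def] by simp
qed

lemma u_unbounded: "\<exists>x. 0 \<le> x \<and> x < 1 \<and> t \<le> u x"
proof -
  obtain K where K: "K > 0" "\<And>z. 0 \<le> z \<Longrightarrow> z \<le> 1 \<Longrightarrow> g z \<le> K * (1 - z)"
    using g_lipschitz_at_1 by blast
  \<comment> \<open>This x solves - ln (1 - x) / K = \<bar>t\<bar>, the left side being the integral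
    of the minorant 1 / (K (1 - z)) over [0, x].\<close>
  define x where "x = 1 - exp (- K * \<bar>t\<bar>)"
  have x: "0 \<le> x" "x < 1" using K(1) unfolding x_def by auto
  have int: "((\<lambda>z. 1 / (K * (1 - z))) has_integral (- ln (1 - x) / K - (- ln (1 - 0) / K))) {0..x}"
  proof (rule fundamental_theorem_of_calculus[OF x(1)])
    fix z assume "z \<in> {0..x}"
    then show "((\<lambda>z. - ln (1 - z) / K) has_vector_derivative 1 / (K * (1 - z))) (at z within {0..x})"
      unfolding has_real_derivative_iff_has_vector_derivative[symmetric]
      using x K(1) by (auto intro!: derivative_eq_intros simp: field_simps)
  qed
  have "integral {0..x} (\<lambda>z. 1 / (K * (1 - z))) \<le> integral {0..x} (\<lambda>z. 1 / g z)"
  proof (rule integral_le)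
    show "(\<lambda>z. 1 / (K * (1 - z))) integrable_on {0..x}" using int by blast
    show "(\<lambda>z. 1 / g z) integrable_on {0..x}" using x by (intro inv_g_integrable) auto
    fix z assume "z \<in> {0..x}"
    then show "1 / (K * (1 - z)) \<le> 1 / g z"
      using K(2)[of z] K(1) g_pos[of z] x by (intro divide_left_mono mult_pos_pos) auto
  qed
  then have "- ln (1 - x) / K \<le> u x"
    using integral_unique[OF int] unfolding u_fun_def by simp
  moreover have "- ln (1 - x) / K = \<bar>t\<bar>" using K(1) unfolding x_def by simp
  ultimately show ?thesis using x by (intro exI[of _ x]) auto
qed

section \<open>The inverse of u and the flow of the differential equation\<close>

definition w :: "real \<Rightarrow> real" where "w = inv_into {0..<1} u"

lemma w_props:
  assumes "0 \<le> t"
  shows "0 \<le> w t" "w t < 1" "u (w t) = t"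
proof -
  obtain b where b: "0 \<le> b" "b < 1" "t \<le> u b" using u_unbounded by blast
  obtain x where x: "0 \<le> x" "x \<le> b" "u x = t"
    using IVT'[of u 0 t b] u_cont[of b] b assms by auto
  then have "t \<in> u ` {0..<1}" using b by force
  then have "inv_into {0..<1} u t \<in> {0..<1}" "u (inv_into {0..<1} u t) = t"
    by (rule inv_into_into, rule f_inv_into_f)
  then show "0 \<le> w t" "w t < 1" "u (w t) = t" by (auto simp: w_def)
qed

lemma w_u [simp]: "0 \<le> x \<Longrightarrow> x < 1 \<Longrightarrow> w (u x) = x"
  unfolding w_def by (rule inv_into_f_f[OF u_inj]) auto

lemma w_lipschitz: 
  assumes "0 \<le> s" "0 \<le> t"
  shows "\<bar>w s - w t\<bar> \<le> \<bar>s - t\<bar>"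
  using assms
proof (induction s t rule: linorder_wlog)
  case (le s t)
  then have "w s \<le> w t" using u_le_iff w_props by metis
  then show ?case using u_diff_ge[of "w s" "w t"] w_props le by auto
next
  case (sym s t)
  then show ?case by (simp add: abs_minus_commute)
qed

lemma w_cont: "continuous_on {0..} w"
proof (rule lipschitz_on_continuous_on)
  show "1-lipschitz_on {0..} w"
    using w_lipschitz by (intro lipschitz_onI) (auto simp: dist_real_def)
qed

text \<open>The inverse function rule turns u' = 1 / g into w' = g w. The chain rule then gives w (u
  s + u y) the derivative g (V s y) / g s in s.\<close>

lemma w_has_derivative:
  assumes "t > 0"
  shows "(w has_real_derivative g (w t)) (at t)"
proof -
  have wt: "0 < w t" "w t < 1"
    using w_props[of t] assms u_0 by (auto simp: order.order_iff_strict)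
  have "(w has_real_derivative inverse (1 / g (w t))) (at t)"
  proof (rule DERIV_inverse_function)
    show "(u has_real_derivative 1 / g (w t)) (at (w t))" using wt by (intro u_has_derivative)
    show "1 / g (w t) \<noteq> 0" using g_pos[of "w t"] wt by auto
    show "0 < t" "t < t + 1" using assms by auto
    show "u (w y) = y" if "0 < y" for y using w_props[of y] that by simp
    show "isCont w t"
      using continuous_on_interior[OF w_cont] assms by (auto simp: interior_real_atLeast)
  qed
  then show ?thesis by simp
qed

lemma V_eq: "x < 1 \<Longrightarrow> y < 1 \<Longrightarrow> V x y = w (u x + u y)"
  by (simp add: V_fun_def w_def)

lemma V_1 [simp]: "V 1 y = 1" "V x 1 = 1" by (simp_all add: V_fun_def)

lemma V_range_strict:
  assumes "0 \<le> x" "x < 1" "0 \<le> y" "y < 1"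
  shows "0 \<le> V x y" "V x y < 1" "u (V x y) = u x + u y"
  using w_props[of "u x + u y"] u_nonneg assms by (auto simp: V_eq)

lemma V_commute: "V x y = V y x" by (auto simp: V_fun_def add.commute)

lemma V_ge:
  assumes "0 \<le> x" "x \<le> 1" "0 \<le> y" "y \<le> 1"
  shows "x \<le> V x y" "y \<le> V x y"
proof -
  have *: "x \<le> V x y" if "0 \<le> x" "x \<le> 1" "0 \<le> y" "y \<le> 1" for x y
  proof (cases "x = 1 \<or> y = 1")
    case False
    then show ?thesis
      using that V_range_strict[of x y] u_nonneg[of y] by (subst u_le_iff[symmetric]) auto
  qed (use that in auto)
  show "x \<le> V x y" "y \<le> V x y" using *[of x y] *[of y x] assms by (simp_all add: V_commute)
qed

lemma V_nonneg: "0 \<le> x \<Longrightarrow> x \<le> 1 \<Longrightarrow> 0 \<le> y \<Longrightarrow> y \<le> 1 \<Longrightarrow> 0 \<le> V x y"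
  using V_ge(1)[of x y] by simp

lemma V_le_1: "0 \<le> x \<Longrightarrow> x \<le> 1 \<Longrightarrow> 0 \<le> y \<Longrightarrow> y \<le> 1 \<Longrightarrow> V x y \<le> 1"
  using V_range_strict(2)[of x y] by (cases "x = 1 \<or> y = 1") auto

lemma V_0 [simp]: "0 \<le> y \<Longrightarrow> y \<le> 1 \<Longrightarrow> V 0 y = y" "0 \<le> x \<Longrightarrow> x \<le> 1 \<Longrightarrow> V x 0 = x"
proof -
  have *: "V 0 y = y" if "0 \<le> y" "y \<le> 1" for y
    using that by (cases "y = 1") (simp_all add: V_eq)
  show "0 \<le> y \<Longrightarrow> y \<le> 1 \<Longrightarrow> V 0 y = y" by (rule *)
  show "0 \<le> x \<Longrightarrow> x \<le> 1 \<Longrightarrow> V x 0 = x" using *[of x] by (subst V_commute) simp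
qed

lemma V_strict_mono:
  assumes "0 \<le> x" "x < 1" "0 \<le> y" "y < y'" "y' \<le> 1"
  shows "V x y < V x y'"
proof (cases "y' = 1")
  case False
  then show ?thesis
    using assms V_range_strict[of x y] V_range_strict[of x y'] u_less[of y y']
    by (subst u_less_iff[symmetric]) auto
qed (use assms V_range_strict[of x y] in auto)

text \<open>The slope of the solution started at y, at time s. It has a second role: as a function
  of y it is the probability, under \<open>mu_g\<close>, that the second coordinate exceeds y given
  that the first is s.\<close>

definition H :: "real \<Rightarrow> real \<Rightarrow> real" where
  "H s y = g (V s y) / g s"

lemma H_range:
  assumes "0 \<le> s" "s < 1" "0 \<le> y" "y \<le> 1"
  shows "0 \<le> H s y" "H s y \<le> 1"
  using g_antimono[of s "V s y"] V_ge[of s y] V_le_1[of s y] g_nonneg[of "V s y"] g_pos[of s] assms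
  by (auto simp: H_def)

lemma V_has_derivative:
  assumes "0 < s" "s < 1" "0 \<le> y" "y \<le> 1"
  shows "((\<lambda>s. V s y) has_real_derivative H s y) (at s)"
proof (cases "y = 1")
  case True
  then show ?thesis by (simp add: H_def g1)
next
  case False
  then have y: "y < 1" using assms by simp
  have "u s + u y > 0" using u_less[of 0 s] u_nonneg[of y] assms y by auto
  then have "(w has_real_derivative g (w (u s + u y))) (at (u s + u y))" by (rule w_has_derivative)
  moreover have "((\<lambda>s. u s + u y) has_real_derivative 1 / g s) (at s)"
    using assms by (auto intro!: derivative_eq_intros u_has_derivative)
  ultimately have "((\<lambda>s. w (u s + u y)) has_real_derivative (g (w (u s + u y)) * (1 / g s))) (at s)"
    by (rule DERIV_chain2)
  then have "((\<lambda>s. w (u s + u y)) has_real_derivative H s y) (at s)"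
    using assms y by (simp add: H_def V_eq)
  then show ?thesis
  proof (rule has_field_derivative_transform_within_open)
    show "open {..<1::real}" by simp
  qed (use assms y in \<open>auto simp: V_eq\<close>)
qed

lemma V_cont_lt1:
  assumes "0 \<le> y" "y \<le> 1" "b < 1"
  shows "continuous_on {0..b} (\<lambda>s. V s y)"
proof (cases "y = 1")
  case False
  then have y: "y < 1" using assms by simp
  have "continuous_on {0..b} (\<lambda>s. w (u s + u y))"
    using u_nonneg assms y
    by (intro continuous_on_compose2[OF w_cont] continuous_intros u_cont) (auto intro!: add_nonneg_nonneg)
  then show ?thesis using assms y by (subst continuous_on_cong[OF refl]) (auto simp: V_eq)
qed auto

lemma V_mvt:
  assumes "0 \<le> s" "s < t" "t < 1" "0 \<le> y" "y \<le> 1"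
  obtains z where "s < z" "z < t" "V t y - V s y = (t - s) * H z y"
proof (rule mvt)
  show "s < t" by fact
  show "continuous_on {s..t} (\<lambda>s. V s y)"
    by (rule continuous_on_subset[OF V_cont_lt1[of y t]]) (use assms in auto)
  show "((\<lambda>s. V s y) has_derivative (*) (H z y)) (at z)" if "s < z" "z < t" for z
    unfolding has_field_derivative_def[symmetric] using that assms by (intro V_has_derivative) auto
qed (use that in \<open>simp add: mult.commute\<close>)

text \<open>For t < 1 the slope \<open>H\<close> lies in [0, 1]. At t = 1, where the equation is
  singular, the claim follows from V 1 y = 1 and s \<le> V s y \<le> 1.\<close>

lemma V_lipschitz:
  assumes "0 \<le> s" "s \<le> t" "t \<le> 1" "0 \<le> y" "y \<le> 1"
  shows "V s y \<le> V t y" "V t y - V s y \<le> t - s"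
proof -
  have "V s y \<le> V t y \<and> V t y - V s y \<le> t - s"
  proof (cases "t = 1 \<or> s = t")
    case True
    then show ?thesis using V_ge[of s y] V_le_1[of s y] assms by auto
  next
    case False
    then have st: "s < t" "t < 1" using assms by auto
    then obtain z where z: "s < z" "z < t" "V t y - V s y = (t - s) * H z y"
      using V_mvt assms by blast
    have "0 \<le> H z y" "H z y \<le> 1" using H_range[of z y] z st assms by auto
    then have "0 \<le> (t - s) * H z y" "(t - s) * H z y \<le> t - s"
      using st by (auto intro: mult_nonneg_nonneg mult_left_le)
    then show ?thesis using z(3) by linarith
  qed
  then show "V s y \<le> V t y" "V t y - V s y \<le> t - s" by auto
qed

lemma V_cont: "0 \<le> y \<Longrightarrow> y \<le> 1 \<Longrightarrow> continuous_on {0..1} (\<lambda>s. V s y)"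
proof (rule lipschitz_on_continuous_on)
  assume y: "0 \<le> y" "y \<le> 1"
  have *: "\<bar>V s y - V t y\<bar> \<le> \<bar>s - t\<bar>" if "s \<in> {0..1}" "t \<in> {0..1}" for s t
    using that V_lipschitz[of s t y] V_lipschitz[of t s y] y by (cases s t rule: linorder_cases) auto
  then show "1-lipschitz_on {0..1} (\<lambda>s. V s y)"
    by (intro lipschitz_onI) (auto simp: dist_real_def)
qed

lemma H_cont: "0 \<le> y \<Longrightarrow> y \<le> 1 \<Longrightarrow> b < 1 \<Longrightarrow> continuous_on {0..b} (\<lambda>s. H s y)"
  unfolding H_def
  using g_pos V_nonneg V_le_1
  by (intro continuous_intros continuous_on_compose2[OF g_cont] continuous_on_subset[OF g_cont] V_cont_lt1)
     (auto simp: less_imp_neq[symmetric] intro: order_trans)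

lemma H_cont_right: "0 \<le> s \<Longrightarrow> s < 1 \<Longrightarrow> continuous_on {0..1} (\<lambda>y. H s y)"
  unfolding H_def using g_pos[of s] V_nonneg V_le_1 V_cont[of s]
  by (intro continuous_intros continuous_on_compose2[OF g_cont])
    (auto simp: V_commute[of s] intro: order_trans)

lemma H_strict_antimono:
  assumes "0 \<le> s" "s < 1" "0 \<le> y" "y < y'" "y' \<le> 1"
  shows "H s y' < H s y"
  unfolding H_def using assms V_strict_mono[OF assms] V_ge[of s y] V_le_1[of s y'] g_pos[of s]
  by (intro divide_strict_right_mono g_less) auto

text \<open>The derivative is at hand only for 0 < s < 1, but V is continuous up to both ends, so
  the fundamental theorem still covers x = 1.\<close>

lemma H_has_integral:
  assumes "0 \<le> x" "x \<le> 1" "0 \<le> y" "y \<le> 1"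
  shows "((\<lambda>s. H s y) has_integral (V x y - y)) {0..x}"
proof -
  have "((\<lambda>s. H s y) has_integral (V x y - V 0 y)) {0..x}"
  proof (rule fundamental_theorem_of_calculus_interior[OF assms(1)])
    show "continuous_on {0..x} (\<lambda>s. V s y)"
      using assms by (intro continuous_on_subset[OF V_cont]) auto
    show "((\<lambda>s. V s y) has_vector_derivative H s y) (at s)" if "s \<in> {0<..<x}" for s
      unfolding has_real_derivative_iff_has_vector_derivative[symmetric]
      using that assms by (intro V_has_derivative) auto
  qed
  then show ?thesis using assms by simp
qed

end

subsection \<open>Existence and uniqueness of the permuton\<close>

abbreviation uniform01 :: "real measure" where
  "uniform01 \<equiv> uniform_measure lborel {0..1}"

lemma prob_space_uniform01: "prob_space uniform01"
  by (rule prob_space_uniform_measure) auto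

lemma measure_uniform01: "A \<in> sets borel \<Longrightarrow> measure uniform01 A = measure lborel ({0..1} \<inter> A)"
  by (subst measure_uniform_measure) auto

lemma measure_uniform01_atLeast: "0 \<le> a \<Longrightarrow> a \<le> 1 \<Longrightarrow> measure uniform01 {a..} = 1 - a"
  by (subst measure_uniform01) (auto simp: Int_atLeastAtMost intro!: arg_cong[of _ _ "measure lborel"]
      simp del: measure_lborel_Icc intro: trans[OF _ measure_lborel_Icc])

lemma measure_uniform01_Ioc: "0 \<le> a \<Longrightarrow> a \<le> b \<Longrightarrow> b \<le> 1 \<Longrightarrow> measure uniform01 {a<..b} = b - a"
proof -
  assume ab: "0 \<le> a" "a \<le> b" "b \<le> 1"
  then have "{0..1} \<inter> {a<..b} = {a<..b}" by auto
  then show ?thesis using ab by (simp add: measure_uniform01)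
qed

lemma AE_uniform01: "AE s in uniform01. 0 < s \<and> s < 1"
proof -
  interpret prob_space uniform01 by (rule prob_space_uniform01)
  have "prob {0<..<1} = 1"
  proof -
    have "{0..1} \<inter> {0<..<1::real} = {0<..<1}" by auto
    then show ?thesis by (simp add: measure_uniform01)
  qed
  then have "AE s in uniform01. s \<in> {0<..<1}" by (intro AE_prob_1) auto
  then show ?thesis by simp
qed

lemma permuton_square_point:
  assumes "permuton \<mu>"
  shows "square_point \<mu> fst snd"
    and "N > 0 \<Longrightarrow> r < N \<Longrightarrow> measure \<mu> {s \<in> space \<mu>. fst s \<in> grid_cell N r} = 1 / real N"
    and "N > 0 \<Longrightarrow> r < N \<Longrightarrow> measure \<mu> {s \<in> space \<mu>. snd s \<in> grid_cell N r} = 1 / real N"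
proof -
  interpret prob_space \<mu> using assms by (simp add: permuton_def)
  have sets [measurable_cong, simp]: "sets \<mu> = sets borel" using assms by (simp add: permuton_def)
  have meas [measurable]: "fst \<in> borel_measurable \<mu>" "snd \<in> borel_measurable \<mu>"
    by (simp_all only: measurable_cong_sets[OF sets refl])
      (intro borel_measurable_continuous_onI continuous_intros)+
  have d: "distr \<mu> borel fst = uniform01" "distr \<mu> borel snd = uniform01"
    using assms by (auto simp: permuton_def)
  have "AE s in uniform01. s \<in> {0<..1}" using AE_uniform01 by eventually_elim auto
  then have "AE s in distr \<mu> borel fst. s \<in> {0<..1}" "AE s in distr \<mu> borel snd. s \<in> {0<..1}"
    by (simp_all only: d)
  then have "AE s in \<mu>. fst s \<in> {0<..1}" "AE s in \<mu>. snd s \<in> {0<..1}"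
    by (simp_all add: AE_distr_iff)
  then show "square_point \<mu> fst snd" by unfold_locales auto
  have cell: "measure uniform01 (grid_cell N r) = 1 / real N" if "N > 0" "r < N"
  proof -
    have "real (Suc r) / real N \<le> 1" using that by (simp add: divide_le_eq)
    then have "measure uniform01 (grid_cell N r) = real (Suc r) / real N - real r / real N"
      unfolding grid_cell_def by (intro measure_uniform01_Ioc divide_right_mono) auto
    then show ?thesis using that by (simp add: diff_divide_distrib[symmetric])
  qed
  have dd: "measure \<mu> {s \<in> space \<mu>. f s \<in> grid_cell N r} = measure (distr \<mu> borel f) (grid_cell N r)"
    if [measurable]: "f \<in> borel_measurable \<mu>" for f
    by (subst measure_distr) (auto intro!: arg_cong[of _ _ "measure \<mu>"])
  show "N > 0 \<Longrightarrow> r < N \<Longrightarrow> measure \<mu> {s \<in> space \<mu>. fst s \<in> grid_cell N r} = 1 / real N"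
    using dd[OF meas(1)] cell d by simp
  show "N > 0 \<Longrightarrow> r < N \<Longrightarrow> measure \<mu> {s \<in> space \<mu>. snd s \<in> grid_cell N r} = 1 / real N"
    using dd[OF meas(2)] cell d by simp
qed

text \<open>All mass lies in the unit square, so the distribution function on the whole plane is
  determined by its values there.\<close>

lemma permuton_clamp:
  assumes "permuton \<mu>"
  shows "measure \<mu> ({..x} \<times> {..y}) =
    (if x < 0 \<or> y < 0 then 0 else measure \<mu> ({..min x 1} \<times> {..min y 1}))"
proof -
  interpret prob_space \<mu> using assms by (simp add: permuton_def)
  have sets [measurable_cong, simp]: "sets \<mu> = sets borel" using assms by (simp add: permuton_def)
  have box: "A \<times> B \<in> sets \<mu>" if "A \<in> sets borel" "B \<in> sets borel" for A B :: "real set"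
    using that unfolding sets borel_prod[symmetric] by (rule pair_measureI)
  have AE: "AE s in \<mu>. s \<in> {0..1} \<times> {0..1}"
    using assms by (intro AE_prob_1) (simp add: permuton_def)
  show ?thesis
  proof (cases "x < 0 \<or> y < 0")
    case True
    have "prob ({..x} \<times> {..y}) = prob {}"
      using AE by (intro finite_measure_eq_AE box) (use True in \<open>auto elim: eventually_mono\<close>)
    then show ?thesis using True by simp
  next
    case False
    have "prob ({..x} \<times> {..y}) = prob ({..min x 1} \<times> {..min y 1})"
      using AE by (intro finite_measure_eq_AE box) (auto elim!: eventually_mono)
    then show ?thesis using False by simp
  qed
qed

text \<open>Lower left quadrants are closed under intersection, generate the Borel sets and exhaust
  the plane along the diagonal. Agreement on the unit square extends to all of them by
  \<open>permuton_clamp\<close>.\<close>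

lemma permuton_unique:
  assumes \<mu>: "permuton \<mu>" and \<nu>: "permuton \<nu>"
    and eq: "\<And>x y. x \<in> {0..1} \<Longrightarrow> y \<in> {0..1} \<Longrightarrow>
      measure \<mu> ({..x} \<times> {..y}) = measure \<nu> ({..x} \<times> {..y})"
  shows "\<mu> = \<nu>"
proof -
  interpret M: prob_space \<mu> using \<mu> by (simp add: permuton_def)
  interpret N: prob_space \<nu> using \<nu> by (simp add: permuton_def)
  have prod: "{..a} = {..fst a} \<times> {..snd a}" for a :: "real \<times> real"
    by (auto simp: less_eq_prod_def)
  let ?E = "range (\<lambda>a::real \<times> real. {..a})"
  show ?thesis
  proof (rule measure_eqI_generator_eq[where E = ?E and \<Omega> = UNIV and A = "\<lambda>i::nat. {..(real i, real i)}"])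
    show "Int_stable ?E"
    proof (rule Int_stableI)
      fix S T assume "S \<in> ?E" "T \<in> ?E"
      then obtain a b where ab: "S = {..a}" "T = {..b}" by blast
      have "S \<inter> T = {..(min (fst a) (fst b), min (snd a) (snd b))}"
        unfolding ab by (auto simp: less_eq_prod_def)
      then show "S \<inter> T \<in> ?E" by blast
    qed
    have "sets borel = sigma_sets UNIV ?E" by (subst borel_eq_atMost) simp
    then show "sets \<mu> = sigma_sets UNIV ?E" "sets \<nu> = sigma_sets UNIV ?E"
      using \<mu> \<nu> by (simp_all add: permuton_def)
    show "emeasure \<mu> X = emeasure \<nu> X" if "X \<in> ?E" for X
    proof -
      obtain a where "X = {..a}" using \<open>X \<in> ?E\<close> by blast
      then have "X = {..fst a} \<times> {..snd a}" using prod[of a] by blast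
      moreover have "measure \<mu> ({..fst a} \<times> {..snd a}) = measure \<nu> ({..fst a} \<times> {..snd a})"
        unfolding permuton_clamp[OF \<mu>, of "fst a"] permuton_clamp[OF \<nu>, of "fst a"] using eq by auto
      ultimately show ?thesis by (simp add: M.emeasure_eq_measure N.emeasure_eq_measure)
    qed
    show "(\<Union>i. {..(real i, real i)}) = (UNIV :: (real \<times> real) set)"
    proof (intro set_eqI iffI UNIV_I)
      fix z :: "real \<times> real"
      obtain i where "max (fst z) (snd z) \<le> real i" using real_arch_simple by blast
      then show "z \<in> (\<Union>i. {..(real i, real i)})" by (auto simp: less_eq_prod_def)
    qed
    show "range (\<lambda>i::nat. {..(real i, real i)}) \<subseteq> ?E" by auto
  qed auto
qed

section \<open>Construction of the permuton from conditional quantiles\<close>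

context profile
begin

lemma H_cont_open: "0 \<le> y \<Longrightarrow> y \<le> 1 \<Longrightarrow> continuous_on {0<..<1} (\<lambda>s. H s y)"
  unfolding H_def
  using g_pos V_nonneg V_le_1
  by (intro continuous_intros continuous_on_compose2[OF g_cont] continuous_on_subset[OF g_cont]
      continuous_on_subset[OF V_cont]) (auto simp: less_imp_neq[symmetric])

lemma H_0: "0 \<le> s \<Longrightarrow> s < 1 \<Longrightarrow> H s 0 = 1" "H s 1 = 0"
  using g_pos[of s] by (auto simp: H_def g1)

text \<open>The conditional law of the second coordinate given that the first is \<open>s\<close> has tail \<open>H s\<close>, so
  its quantile function turns a second independent uniform variable into that coordinate.\<close>

definition Q :: "real \<Rightarrow> real \<Rightarrow> real" where
  "Q s r = (if 0 < s \<and> s < 1 \<and> 0 < r \<and> r < 1 then SOME y. y \<in> {0..1} \<and> H s y = r else 0)"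

lemma Q_range: "0 \<le> Q s r" "Q s r \<le> 1"
  and Q_eq: "0 < s \<Longrightarrow> s < 1 \<Longrightarrow> 0 < r \<Longrightarrow> r < 1 \<Longrightarrow> H s (Q s r) = r"
proof -
  have *: "Q s r \<in> {0..1} \<and> H s (Q s r) = r" if "0 < s" "s < 1" "0 < r" "r < 1"
  proof -
    have "\<exists>y. 0 \<le> y \<and> y \<le> 1 \<and> H s y = r"
      using that H_0 H_cont_right by (intro IVT2') auto
    then have "\<exists>y. y \<in> {0..1} \<and> H s y = r" by auto
    then have "(SOME y. y \<in> {0..1} \<and> H s y = r) \<in> {0..1} \<and> H s (SOME y. y \<in> {0..1} \<and> H s y = r) = r"
      by (rule someI_ex)
    then show ?thesis unfolding Q_def using that by simp
  qed
  then show "0 < s \<Longrightarrow> s < 1 \<Longrightarrow> 0 < r \<Longrightarrow> r < 1 \<Longrightarrow> H s (Q s r) = r" by simp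
  show "0 \<le> Q s r" "Q s r \<le> 1"
    using * by (cases "0 < s \<and> s < 1 \<and> 0 < r \<and> r < 1"; auto simp: Q_def)+
qed

text \<open>\<open>Q s\<close> inverts the strictly decreasing function \<open>H s\<close>, which
  flips the inequality. For uniform r the event Q s r \<le> y thus has probability 1 - H s
  y.\<close>

lemma Q_le_iff:
  assumes "0 < s" "s < 1" "0 < r" "r < 1" "0 \<le> y" "y \<le> 1"
  shows "Q s r \<le> y \<longleftrightarrow> H s y \<le> r"
  using H_strict_antimono[of s "Q s r" y] H_strict_antimono[of s y "Q s r"] Q_eq[of s r] Q_range[of s r] assms
  by (cases "Q s r" y rule: linorder_cases) auto

lemma H_measurable:
  assumes "0 \<le> y" "y \<le> 1"
  shows "(\<lambda>s. indicator {0<..<1} s * H s y) \<in> borel_measurable borel"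
  using borel_measurable_continuous_on_indicator[OF _ H_cont_open[OF assms]] by simp

text \<open>\<open>Q\<close> is chosen pointwise, so measurability is read off its sublevel sets,
  which \<open>Q_le_iff\<close> describes by the measurable function \<open>H\<close> at level y.
  Off the open unit square \<open>Q\<close> is 0, hence at most y in the last case; this is why the
  set is written with an implication.\<close>

lemma Q_measurable: "(\<lambda>z. Q (fst z) (snd z)) \<in> borel_measurable (borel \<Otimes>\<^sub>M borel)"
proof (rule borel_measurableI_le)
  fix y :: real
  consider "y < 0" | "y \<ge> 1" | "0 \<le> y" "y < 1" by linarith
  then show "{z \<in> space (borel \<Otimes>\<^sub>M borel). Q (fst z) (snd z) \<le> y} \<in> sets (borel \<Otimes>\<^sub>M borel)"
  proof cases
    case 1
    then have "{z \<in> space (borel \<Otimes>\<^sub>M borel). Q (fst z) (snd z) \<le> y} = {}"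
      using Q_range(1) by (auto simp: not_le intro: less_le_trans)
    then show ?thesis by (simp only: sets.empty_sets)
  next
    case 2
    then have "{z \<in> space (borel \<Otimes>\<^sub>M borel). Q (fst z) (snd z) \<le> y} = space (borel \<Otimes>\<^sub>M borel)"
      using Q_range(2) by (auto intro: order_trans)
    then show ?thesis by (simp only: sets.top)
  next
    case 3
    note [measurable] = H_measurable[of y, OF 3(1) less_imp_le[OF 3(2)]]
    have "{z \<in> space (borel \<Otimes>\<^sub>M borel). Q (fst z) (snd z) \<le> y} =
      {z \<in> space (borel \<Otimes>\<^sub>M borel). 0 < fst z \<and> fst z < 1 \<and> 0 < snd z \<and> snd z < 1 \<longrightarrow>
         indicator {0<..<1} (fst z) * H (fst z) y \<le> snd z}"
      using Q_le_iff 3 by (auto simp: Q_def)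
    also have "\<dots> \<in> sets (borel \<Otimes>\<^sub>M borel)" by measurable
    finally show ?thesis .
  qed
qed

definition base :: "(real \<times> real) measure" where
  "base = uniform01 \<Otimes>\<^sub>M uniform01"

definition mu_g :: "(real \<times> real) measure" where
  "mu_g = distr base borel (\<lambda>z. (fst z, Q (fst z) (snd z)))"

lemma prob_space_base: "prob_space base"
proof -
  interpret prob_space uniform01 by (rule prob_space_uniform01)
  interpret pair_prob_space uniform01 uniform01 ..
  show ?thesis unfolding base_def by unfold_locales
qed

lemma sets_base [measurable_cong]: "sets base = sets (borel \<Otimes>\<^sub>M borel)"
  unfolding base_def by (rule sets_pair_measure_cong) auto

lemma base_measurable [measurable]: "(\<lambda>z. (fst z, Q (fst z) (snd z))) \<in> measurable base borel"
proof -
  note Q_measurable [measurable]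
  show ?thesis unfolding borel_prod[symmetric] by measurable
qed

text \<open>Integrating out the second uniform variable leaves 1 - H s y for s < x, and the integral
  of \<open>H\<close> over [0, x] is V x y - y.\<close>

lemma base_cdf:
  assumes x: "0 \<le> x" "x \<le> 1" and y: "0 \<le> y" "y \<le> 1"
  shows "measure base {z \<in> space base. fst z \<le> x \<and> Q (fst z) (snd z) \<le> y} = F_fun g x y"
proof -
  interpret P: prob_space uniform01 by (rule prob_space_uniform01)
  note Q_measurable [measurable]
  note [measurable] = H_measurable[OF y]
  let ?A = "{z \<in> space base. fst z \<le> x \<and> Q (fst z) (snd z) \<le> y}"
  let ?f = "\<lambda>s. indicator {0<..<x} s * (1 - indicator {0<..<1} s * H s y)"
  have A: "?A \<in> sets (uniform01 \<Otimes>\<^sub>M uniform01)"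
    unfolding base_def[symmetric] by measurable
  have f_nonneg: "0 \<le> ?f s" for s using H_range(2)[of s y] y by (auto split: split_indicator)
  have "emeasure base ?A = (\<integral>\<^sup>+ s. emeasure uniform01 (Pair s -` ?A) \<partial>uniform01)"
    using A unfolding base_def by (rule P.emeasure_pair_measure_alt)
  also have "\<dots> = (\<integral>\<^sup>+ s. ennreal (?f s) \<partial>uniform01)"
  proof (rule nn_integral_cong_AE)
    \<comment> \<open>The event contains s = x while the integrand is cut off to the open interval;
      a single point is negligible.\<close>
    have ne: "AE s in uniform01. s \<noteq> x"
      by (rule AE_uniform_measureI) (auto intro: AE_lborel_singleton eventually_mono)
    show "AE s in uniform01. emeasure uniform01 (Pair s -` ?A) = ennreal (?f s)"
      using AE_uniform01 ne
    proof eventually_elim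
      case (elim s)
      then have s: "0 < s" "s < 1" "s \<noteq> x" by auto
      have A': "Pair s -` ?A \<in> sets uniform01" using A by (rule sets_Pair1)
      show ?case
      proof (cases "s < x")
        case True
        have "P.prob (Pair s -` ?A) = P.prob {H s y..}"
        proof (rule P.finite_measure_eq_AE)
          show "AE r in uniform01. (r \<in> Pair s -` ?A) = (r \<in> {H s y..})"
            using AE_uniform01
          proof eventually_elim
            case (elim r)
            then show ?case using Q_le_iff[of s r y] s y True by (auto simp: base_def space_pair_measure)
          qed
          show "Pair s -` ?A \<in> P.events" by (rule A')
          show "{H s y..} \<in> P.events" by simp
        qed
        also have "\<dots> = 1 - H s y" using H_range[of s y] s y by (intro measure_uniform01_atLeast) auto
        finally show ?thesis using True s by (simp add: P.emeasure_eq_measure)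
      next
        case False
        then have "Pair s -` ?A = {}" using s by auto
        then show ?thesis using False s by simp
      qed
    qed
  qed
  also have "\<dots> = (\<integral>\<^sup>+ s. ennreal (?f s) * indicator {0..1} s \<partial>lborel)"
    by (subst nn_integral_uniform_measure) (auto simp: divide_ennreal_def)
  also have "\<dots> = (\<integral>\<^sup>+ s. ennreal (?f s) \<partial>lborel)"
    using x by (intro nn_integral_cong) (auto split: split_indicator)
  also have "\<dots> = ennreal (x - (V x y - y))"
  proof (rule nn_integral_has_integral_lborel)
    show "?f \<in> borel_measurable borel" by measurable
    show "0 \<le> ?f s" for s by (rule f_nonneg)
    have "((\<lambda>s. 1 - H s y) has_integral (x - (V x y - y))) {0..x}"
      using has_integral_diff[OF has_integral_const_real[of 1 0 x] H_has_integral[OF x y]] x by simp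
    then have "((\<lambda>s. 1 - H s y) has_integral (x - (V x y - y))) {0<..<x}"
      using has_integral_open_interval[of "\<lambda>s. 1 - H s y" _ 0 x] by (simp add: cbox_interval box_real)
    then have "((\<lambda>s. if s \<in> {0<..<x} then 1 - H s y else 0) has_integral (x - (V x y - y))) UNIV"
      by (simp only: has_integral_restrict_UNIV)
    moreover have "(\<lambda>s. if s \<in> {0<..<x} then 1 - H s y else 0) = ?f"
      using x by (auto split: split_indicator)
    ultimately show "(?f has_integral (x - (V x y - y))) UNIV" by simp
  qed
  finally have "emeasure base ?A = ennreal (x - (V x y - y))" .
  moreover have "V x y - y \<le> x" using V_lipschitz(2)[of 0 x y] x y by simp
  ultimately show ?thesis by (simp add: measure_def F_fun_def)
qed

lemma mu_g_cdf:
  assumes "x \<in> {0..1}" "y \<in> {0..1}"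
  shows "measure mu_g ({..x} \<times> {..y}) = F_fun g x y"
proof -
  have "measure mu_g ({..x} \<times> {..y}) =
      measure base ((\<lambda>z. (fst z, Q (fst z) (snd z))) -` ({..x} \<times> {..y}) \<inter> space base)"
    unfolding mu_g_def by (intro measure_distr base_measurable)
      (auto simp: borel_prod[symmetric] intro!: pair_measureI)
  also have "\<dots> = measure base {z \<in> space base. fst z \<le> x \<and> Q (fst z) (snd z) \<le> y}"
    by (intro arg_cong[of _ _ "measure base"]) auto
  finally show ?thesis using base_cdf assms by simp
qed

lemma permuton_mu_g: "permuton mu_g"
proof -
  interpret P: prob_space uniform01 by (rule prob_space_uniform01)
  interpret B: prob_space base by (rule prob_space_base)
  interpret G: prob_space mu_g unfolding mu_g_def by (rule B.prob_space_distr) measurable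
  note Q_measurable [measurable]
  have fst_snd: "fst \<in> measurable (borel :: (real \<times> real) measure) borel"
    "snd \<in> measurable (borel :: (real \<times> real) measure) borel"
    by (simp_all add: borel_prod[symmetric])
  have box: "{0..1::real} \<times> {0..1::real} \<in> sets borel"
    unfolding borel_prod[symmetric] by (rule pair_measureI) auto
  have AE_fst: "AE z in base. 0 < fst z \<and> fst z < 1"
  proof -
    have "AE z in distr base uniform01 fst. 0 < z \<and> z < 1"
      unfolding base_def P.distr_pair_fst by (rule AE_uniform01)
    then show ?thesis unfolding base_def by (rule AE_distrD[rotated]) measurable
  qed
  have AE_mu: "AE z in mu_g. z \<in> {0..1} \<times> {0..1}"
    unfolding mu_g_def
  proof (subst AE_distr_iff[OF base_measurable])
    show "{z \<in> space borel. z \<in> {0..1::real} \<times> {0..1::real}} \<in> sets borel" using box by simp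
    show "AE z in base. (fst z, Q (fst z) (snd z)) \<in> {0..1} \<times> {0..1}"
      using AE_fst by eventually_elim (use Q_range in auto)
  qed
  have sets: "sets mu_g = sets borel" by (simp add: mu_g_def)
  have m1: "measure mu_g ({0..1} \<times> {0..1}) = 1"
    using AE_mu box by (subst G.prob_eq_1) (auto simp: sets)
  have f: "distr mu_g borel fst = uniform01"
  proof -
    have "distr mu_g borel fst = distr base borel fst"
      unfolding mu_g_def by (subst distr_distr[OF fst_snd(1) base_measurable]) (simp add: comp_def)
    also have "\<dots> = distr base uniform01 fst" by (rule distr_cong) auto
    also have "\<dots> = uniform01" unfolding base_def by (rule P.distr_pair_fst)
    finally show ?thesis .
  qed
  have "distributed base lborel (\<lambda>z. Q (fst z) (snd z)) (\<lambda>x. indicator {0..1} x / measure lborel {0..1::real})"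
  proof (rule B.uniform_distrI_borel_atLeastAtMost)
    fix y :: real assume y: "0 \<le> y" "y \<le> 1"
    \<comment> \<open>Almost surely the first coordinate is below 1, so the second marginal is the
      value at x = 1, where F (1, y) = 1 + y - V 1 y = y.\<close>
    have "B.prob {z \<in> space base. Q (fst z) (snd z) \<le> y} =
        B.prob {z \<in> space base. fst z \<le> 1 \<and> Q (fst z) (snd z) \<le> y}"
    proof (rule B.finite_measure_eq_AE)
      show "AE z in base. (z \<in> {z \<in> space base. Q (fst z) (snd z) \<le> y}) =
          (z \<in> {z \<in> space base. fst z \<le> 1 \<and> Q (fst z) (snd z) \<le> y})"
        using AE_fst by eventually_elim auto
    qed measurable
    then show "B.prob {z \<in> space base. Q (fst z) (snd z) \<le> y} = (y - 0) / (1 - 0)"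
      using base_cdf[of 1 y] y by (simp add: F_fun_def)
  qed (auto, measurable)
  then have "distr base lborel (\<lambda>z. Q (fst z) (snd z)) = density lborel (\<lambda>x. indicator {0..1} x / measure lborel {0..1::real})"
    by (simp add: distributed_def)
  then have Q_distr: "distr base lborel (\<lambda>z. Q (fst z) (snd z)) = uniform01"
    by (simp add: uniform_measure_def divide_ennreal_def ennreal_indicator)
  have s: "distr mu_g borel snd = uniform01"
  proof -
    have "distr mu_g borel snd = distr base borel (\<lambda>z. Q (fst z) (snd z))"
      unfolding mu_g_def by (subst distr_distr[OF fst_snd(2) base_measurable]) (simp add: comp_def)
    also have "\<dots> = distr base lborel (\<lambda>z. Q (fst z) (snd z))" by (rule distr_cong) auto
    finally show ?thesis using Q_distr by simp
  qed
  show ?thesis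
    unfolding permuton_def using sets m1 f s G.prob_space_axioms by simp
qed

lemma mu_perm_eq: "mu_perm g = mu_g"
  unfolding mu_perm_def
proof (rule the_equality)
  show "permuton mu_g \<and> (\<forall>x\<in>{0..1}. \<forall>y\<in>{0..1}. measure mu_g ({..x} \<times> {..y}) = F_fun g x y)"
    using permuton_mu_g mu_g_cdf by blast
  fix \<mu> assume "permuton \<mu> \<and> (\<forall>x\<in>{0..1}. \<forall>y\<in>{0..1}. measure \<mu> ({..x} \<times> {..y}) = F_fun g x y)"
  then show "\<mu> = mu_g" using permuton_mu_g mu_g_cdf by (intro permuton_unique) auto
qed

end

subsection \<open>Counting the small values picked by the sequential choices\<close>

text \<open>The equivalence is what makes the small values a Markov chain: whether the pick is at
  most m depends on D only through the number of elements of D that are at most m.\<close>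

lemma kth_smallest_props:
  assumes "finite D" "1 \<le> l" "l \<le> card D"
  shows "kth_smallest D l \<in> D" "kth_smallest D l \<le> m \<longleftrightarrow> l \<le> card {x \<in> D. x \<le> m}"
proof -
  define xs where "xs = sorted_list_of_set D"
  have len: "length xs = card D" and set: "set xs = D" and dist: "distinct xs" and srt: "sorted xs"
    using assms unfolding xs_def by auto
  have nth: "kth_smallest D l = xs ! (l - 1)" by (simp add: kth_smallest_def xs_def)
  have lt: "l - 1 < length xs" using assms len by simp
  show "kth_smallest D l \<in> D" using nth_mem[OF lt] by (simp add: nth set)
  have inj: "inj_on ((!) xs) {..<j}" if "j \<le> length xs" for j
    using that dist by (auto simp: inj_on_def nth_eq_iff_index_eq)
  show "kth_smallest D l \<le> m \<longleftrightarrow> l \<le> card {x \<in> D. x \<le> m}"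
  proof
    assume le: "kth_smallest D l \<le> m"
    have "(!) xs ` {..<l} \<subseteq> {x \<in> D. x \<le> m}"
    proof
      fix x assume "x \<in> (!) xs ` {..<l}"
      then obtain j where j: "j < l" "x = xs ! j" by auto
      have "xs ! j \<le> xs ! (l - 1)" using j srt lt by (intro sorted_nth_mono) auto
      moreover have "xs ! j \<in> D" using j lt nth_mem[of j xs] by (simp add: set)
      ultimately show "x \<in> {x \<in> D. x \<le> m}" using le j by (simp add: nth)
    qed
    then have "card ((!) xs ` {..<l}) \<le> card {x \<in> D. x \<le> m}" using assms by (intro card_mono) auto
    then show "l \<le> card {x \<in> D. x \<le> m}" using inj[of l] assms len by (simp add: card_image)
  next
    assume le: "l \<le> card {x \<in> D. x \<le> m}"
    show "kth_smallest D l \<le> m"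
    proof (rule ccontr)
      assume nle: "\<not> kth_smallest D l \<le> m"
      have "{x \<in> D. x \<le> m} \<subseteq> (!) xs ` {..<l - 1}"
      proof
        fix x assume x: "x \<in> {x \<in> D. x \<le> m}"
        then obtain j where j: "j < length xs" "x = xs ! j" using set by (auto simp: in_set_conv_nth)
        have "j < l - 1"
        proof (rule ccontr)
          assume "\<not> j < l - 1"
          then have "xs ! (l - 1) \<le> xs ! j" using j srt by (intro sorted_nth_mono) auto
          then show False using x j nle by (simp add: nth)
        qed
        then show "x \<in> (!) xs ` {..<l - 1}" using j by auto
      qed
      then have "card {x \<in> D. x \<le> m} \<le> card ((!) xs ` {..<l - 1})" by (intro card_mono) auto
      also have "\<dots> \<le> l - 1" using card_image_le[of "{..<l - 1}" "(!) xs"] by simp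
      finally show False using le assms(2) by simp
    qed
  qed
qed

definition valid_choices :: "nat \<Rightarrow> (nat \<Rightarrow> nat) \<Rightarrow> bool" where
  "valid_choices n c \<longleftrightarrow> (\<forall>i<n. 1 \<le> c (Suc i) \<and> c (Suc i) \<le> n - i)"

text \<open>The number of remaining values that are at most m, written through the choices alone. A
  valid choice is at least 1, so a chain at 0 stays there and the natural subtraction never
  truncates.\<close>

primrec chain :: "nat \<Rightarrow> (nat \<Rightarrow> nat) \<Rightarrow> nat \<Rightarrow> nat" where
  "chain m c 0 = m"
| "chain m c (Suc i) = chain m c i - (if c (Suc i) \<le> chain m c i then 1 else 0)"

lemma remaining_props:
  assumes c: "valid_choices n c" and "i \<le> n"
  shows "remaining n c i \<subseteq> {1..n} \<and> card (remaining n c i) = n - i"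
  using \<open>i \<le> n\<close>
proof (induction i)
  case (Suc i)
  then have IH: "remaining n c i \<subseteq> {1..n}" "card (remaining n c i) = n - i" by auto
  have fin: "finite (remaining n c i)" using IH(1) by (rule finite_subset) simp
  have "kth_smallest (remaining n c i) (c (Suc i)) \<in> remaining n c i"
    using c Suc.prems IH fin by (intro kth_smallest_props) (auto simp: valid_choices_def)
  then show ?case using IH fin by auto
qed auto

lemma finite_remaining: "valid_choices n c \<Longrightarrow> i \<le> n \<Longrightarrow> finite (remaining n c i)"
  using remaining_props[of n c i] finite_subset by blast

lemma perm_of_choices_Suc:
  assumes c: "valid_choices n c" and i: "i < n"
  shows "perm_of_choices n c (Suc i) \<in> remaining n c i"
    and "perm_of_choices n c (Suc i) \<le> m \<longleftrightarrow> c (Suc i) \<le> card {x \<in> remaining n c i. x \<le> m}"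
    and "remaining n c (Suc i) = remaining n c i - {perm_of_choices n c (Suc i)}"
proof -
  have eq: "perm_of_choices n c (Suc i) = kth_smallest (remaining n c i) (c (Suc i))"
    using i by (simp add: perm_of_choices_def)
  have *: "finite (remaining n c i)" "1 \<le> c (Suc i)" "c (Suc i) \<le> card (remaining n c i)"
    using c i finite_remaining[of n c i] remaining_props[of n c i] by (auto simp: valid_choices_def)
  show "perm_of_choices n c (Suc i) \<in> remaining n c i"
    and "perm_of_choices n c (Suc i) \<le> m \<longleftrightarrow> c (Suc i) \<le> card {x \<in> remaining n c i. x \<le> m}"
    unfolding eq using kth_smallest_props[OF *] by auto
  show "remaining n c (Suc i) = remaining n c i - {perm_of_choices n c (Suc i)}"
    unfolding eq by simp
qed

text \<open>Every pick comes from what is left, so no value repeats; at i = n this makes the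
  construction a permutation of {1..n}.\<close>

lemma remaining_image:
  assumes c: "valid_choices n c" and "i \<le> n"
  shows "inj_on (perm_of_choices n c) {1..i} \<and> perm_of_choices n c ` {1..i} \<subseteq> {1..n} \<and>
    remaining n c i = {1..n} - perm_of_choices n c ` {1..i}"
  using \<open>i \<le> n\<close>
proof (induction i)
  case (Suc i)
  let ?\<sigma> = "perm_of_choices n c"
  have i: "i < n" using Suc by simp
  have IH: "inj_on ?\<sigma> {1..i}" "?\<sigma> ` {1..i} \<subseteq> {1..n}" "remaining n c i = {1..n} - ?\<sigma> ` {1..i}"
    using Suc by auto
  have new: "?\<sigma> (Suc i) \<in> {1..n} - ?\<sigma> ` {1..i}"
    using perm_of_choices_Suc(1)[OF c i] unfolding IH(3) .
  have "{1..Suc i} = insert (Suc i) {1..i}" by auto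
  then show ?case
    using IH new perm_of_choices_Suc(3)[OF c i] by (auto simp del: remaining.simps)
qed simp

lemma perm_of_choices_bij:
  assumes c: "valid_choices n c"
  shows "bij_betw (perm_of_choices n c) {1..n} {1..n}"
  using remaining_image[OF c order_refl] endo_inj_surj[of "{1..n}" "perm_of_choices n c"]
  by (auto simp: bij_betw_def)

text \<open>If i plus the chain already equals n, every valid choice is at most n - i, which is the
  chain itself, so the chain must decrease.\<close>

lemma chain_le:
  assumes c: "valid_choices n c" and "m \<le> n" "i \<le> n"
  shows "i + chain m c i \<le> n"
  using \<open>i \<le> n\<close>
proof (induction i)
  case (Suc i)
  then have "c (Suc i) \<le> n - i" "1 \<le> c (Suc i)" using c by (auto simp: valid_choices_def)
  then show ?case using Suc by auto
qed (use assms in simp)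

lemma chain_eq_card:
  assumes c: "valid_choices n c" and m: "m \<le> n" and "i \<le> n"
  shows "chain m c i = card {x \<in> remaining n c i. x \<le> m}"
  using \<open>i \<le> n\<close>
proof (induction i)
  case 0
  have "{x \<in> {1..n}. x \<le> m} = {1..m}" using m by auto
  then show ?case by simp
next
  case (Suc i)
  then have i: "i < n" and IH: "chain m c i = card {x \<in> remaining n c i. x \<le> m}" by auto
  let ?s = "perm_of_choices n c (Suc i)" and ?B = "{x \<in> remaining n c i. x \<le> m}"
  have fin: "finite ?B" using finite_remaining[OF c, of i] i by simp
  have eq: "{x \<in> remaining n c (Suc i). x \<le> m} = ?B - {?s}"
    unfolding perm_of_choices_Suc(3)[OF c i] by auto
  show ?case
    unfolding eq using IH fin perm_of_choices_Suc(1)[OF c i] perm_of_choices_Suc(2)[OF c i, of m] by (auto simp: card_Diff_singleton_if)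
qed

text \<open>Each of the values 1, ..., m is either taken at one of the positions 1, ..., i or still
  remains. The empirical distribution function is therefore m minus the chain, divided by n.\<close>

lemma card_small_values:
  assumes c: "valid_choices n c" and m: "m \<le> n" and i: "i \<le> n"
  shows "card {j \<in> {1..i}. perm_of_choices n c j \<le> m} + chain m c i = m"
proof -
  let ?\<sigma> = "perm_of_choices n c"
  have inj: "inj_on ?\<sigma> {1..i}" and img: "?\<sigma> ` {1..i} \<subseteq> {1..n}"
    and rem: "remaining n c i = {1..n} - ?\<sigma> ` {1..i}"
    using remaining_image[OF c i] by blast+
  let ?A = "?\<sigma> ` {j \<in> {1..i}. ?\<sigma> j \<le> m}" and ?B = "{x \<in> remaining n c i. x \<le> m}"
  have "card ?A = card {j \<in> {1..i}. ?\<sigma> j \<le> m}"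
    by (rule card_image, rule inj_on_subset[OF inj]) blast
  moreover have "card (?A \<union> ?B) = card ?A + card ?B"
  proof (rule card_Un_disjoint)
    show "?A \<inter> ?B = {}" unfolding rem by blast
  qed (use finite_remaining[OF c i] in simp_all)
  moreover have "?A \<union> ?B = {1..m}"
  proof -
    have "?A \<union> ?B = {x \<in> {1..n}. x \<le> m}" unfolding rem using img by blast
    also have "\<dots> = {1..m}" using m by auto
    finally show ?thesis .
  qed
  ultimately show ?thesis using chain_eq_card[OF c m i] by simp
qed

lemma chain_cong: "(\<And>j. 1 \<le> j \<Longrightarrow> j \<le> i \<Longrightarrow> c j = d j) \<Longrightarrow> chain m c i = chain m d i"
  by (induction i) auto

subsection \<open>Concentration of the empirical distribution function\<close>

definition emp_cdf :: "nat \<Rightarrow> (nat \<Rightarrow> nat) \<Rightarrow> real \<Rightarrow> real \<Rightarrow> real" where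
  "emp_cdf n \<sigma> x y =
     real (card {i \<in> {1..n}. real i \<le> real n * x \<and> real (\<sigma> i) \<le> real n * y}) / real n"

text \<open>Here D is the error before a step, \<delta> the increment of the solution, e the step
  size, q the probability that the scaled chain moves up, and h the slope at the solution. In the
  expanded mean square, 2 D (h e - \<delta>) is the local error of the Euler scheme, 2 D (q - h) e
  is nonpositive by dissipativity, and the remainder is a convex combination of squares of size at
  most e^2.\<close>

lemma step_bound:
  fixes D \<delta> q h \<rho> e :: real
  assumes "0 \<le> q" "q \<le> 1" "D * (q - h) \<le> 0" "\<bar>D\<bar> \<le> 1" "\<bar>h * e - \<delta>\<bar> \<le> \<rho> * e" "0 \<le> \<delta>" "\<delta> \<le> e"
  shows "(D - \<delta>)\<^sup>2 + q * ((D - \<delta> + e)\<^sup>2 - (D - \<delta>)\<^sup>2) \<le> D\<^sup>2 + 2 * \<rho> * e + e\<^sup>2"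
proof -
  have e: "0 \<le> e" using assms by linarith
  have "D * (h * e - \<delta>) \<le> \<bar>D\<bar> * \<bar>h * e - \<delta>\<bar>" by (metis abs_ge_self abs_mult)
  also have "\<dots> \<le> 1 * (\<rho> * e)" using assms by (intro mult_mono) auto
  finally have 1: "D * (h * e - \<delta>) \<le> \<rho> * e" by simp
  have 2: "D * (q - h) * e \<le> 0" using assms(3) e by (rule mult_nonpos_nonneg)
  have "(1 - q) * \<delta>\<^sup>2 \<le> (1 - q) * e\<^sup>2" "q * (e - \<delta>)\<^sup>2 \<le> q * e\<^sup>2"
    using assms by (auto intro!: mult_left_mono power_mono)
  then have 3: "(1 - q) * \<delta>\<^sup>2 + q * (e - \<delta>)\<^sup>2 \<le> e\<^sup>2" by (simp add: algebra_simps)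
  have "(D - \<delta>)\<^sup>2 + q * ((D - \<delta> + e)\<^sup>2 - (D - \<delta>)\<^sup>2) =
      D\<^sup>2 + 2 * (D * (h * e - \<delta>)) + 2 * (D * (q - h) * e) + ((1 - q) * \<delta>\<^sup>2 + q * (e - \<delta>)\<^sup>2)"
    by (simp add: power2_eq_square algebra_simps)
  also have "\<dots> \<le> D\<^sup>2 + 2 * (\<rho> * e) + 2 * 0 + e\<^sup>2"
    using 1 2 3 by linarith
  finally show ?thesis by simp
qed

lemma chain_le_start: "chain m c i \<le> m"
  by (induction i) auto

section \<open>Transition law and second moment of the chain\<close>

context profile
begin

lemma set_nu:
  assumes "i < n"
  shows "set_pmf (nu g n (Suc i)) \<subseteq> {1..n - i}"
  using assms by (auto simp: set_pmf_iff pmf_nu[OF dec g1] nu_weight_def split: if_splits)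

text \<open>The weights telescope. The complementary probability g ((i + a) / n) / g (i / n) is that
  of the chain not decreasing, that is, of (i + chain) / n moving up by 1 / n.\<close>

lemma prob_nu_atMost:
  assumes "i < n" "a \<le> n - i"
  shows "measure_pmf.prob (nu g n (Suc i)) {..a} = 1 - g (real (i + a) / real n) / g (real i / real n)"
proof -
  have pos: "g (real i / real n) > 0" using assms by (intro g_pos) auto
  have "measure_pmf.prob (nu g n (Suc i)) {..a} = (\<Sum>l\<le>a. nu_weight g n (Suc i) l)"
    using assms by (subst measure_measure_pmf_finite) (auto simp: pmf_nu[OF dec g1])
  also have "\<dots> = 1 - g (real (i + a) / real n) / g (real i / real n)"
    using assms(2)
  proof (induction a)
    case 0
    then show ?case using pos by (simp add: nu_weight_def)
  next
    case (Suc a)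
    then have "nu_weight g n (Suc i) (Suc a) =
        (g (real (i + a) / real n) - g (real (i + Suc a) / real n)) / g (real i / real n)"
      by (simp add: nu_weight_def ac_simps)
    moreover have "(\<Sum>l\<le>a. nu_weight g n (Suc i) l) =
        1 - g (real (i + a) / real n) / g (real i / real n)"
      using Suc by (intro Suc.IH) simp
    ultimately show ?case by (simp add: diff_divide_distrib)
  qed
  finally show ?thesis .
qed

abbreviation choices :: "nat \<Rightarrow> (nat \<Rightarrow> nat) pmf" where
  "choices n \<equiv> Pi_pmf {1..n} 0 (nu g n)"

definition law :: "nat \<Rightarrow> nat \<Rightarrow> nat \<Rightarrow> nat pmf" where
  "law n m i = map_pmf (\<lambda>c. chain m c i) (choices n)"

lemma choices_valid:
  assumes "c \<in> set_pmf (choices n)"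
  shows "valid_choices n c"
  unfolding valid_choices_def
proof (intro allI impI)
  fix i assume i: "i < n"
  then have "c (Suc i) \<in> set_pmf (nu g n (Suc i))"
    using assms set_Pi_pmf[of "{1..n}" 0 "nu g n"] by (auto simp: PiE_dflt_def)
  then show "1 \<le> c (Suc i) \<and> c (Suc i) \<le> n - i" using set_nu[OF i] by auto
qed

lemma set_law:
  assumes "m \<le> n" "i \<le> n" "a \<in> set_pmf (law n m i)"
  shows "i + a \<le> n" "a \<le> m"
  using assms chain_le choices_valid chain_le_start by (auto simp: law_def)

text \<open>The Markov property: the chain after i steps depends on the choices 1, ..., i only, and
  choice i + 1 is independent of these.\<close>

lemma law_Suc:
  assumes "i < n"
  shows "law n m (Suc i) =
    bind_pmf (law n m i) (\<lambda>a. map_pmf (\<lambda>l. a - (if l \<le> a then 1 else 0)) (nu g n (Suc i)))"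
proof -
  have restrict: "law n m j = map_pmf (\<lambda>c. chain m c j) (Pi_pmf {1..j} 0 (nu g n))" if "j \<le> n" for j
  proof -
    have "Pi_pmf {1..j} 0 (nu g n) = map_pmf (\<lambda>f x. if x \<in> {1..j} then f x else 0) (choices n)"
      using that by (intro Pi_pmf_subset) auto
    then have "map_pmf (\<lambda>c. chain m c j) (Pi_pmf {1..j} 0 (nu g n)) =
        map_pmf (\<lambda>c. chain m (\<lambda>x. if x \<in> {1..j} then c x else 0) j) (choices n)"
      by (simp add: map_pmf_comp)
    also have "\<dots> = law n m j"
      unfolding law_def by (intro map_pmf_cong refl chain_cong) auto
    finally show ?thesis ..
  qed
  have ins: "{1..Suc i} = insert (Suc i) {1..i}" by auto
  have "law n m (Suc i) = map_pmf (\<lambda>c. chain m c (Suc i)) (Pi_pmf (insert (Suc i) {1..i}) 0 (nu g n))"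
    using restrict[of "Suc i"] assms unfolding ins by simp
  also have "Pi_pmf (insert (Suc i) {1..i}) 0 (nu g n) =
      do {l \<leftarrow> nu g n (Suc i); c \<leftarrow> Pi_pmf {1..i} 0 (nu g n); return_pmf (c(Suc i := l))}"
    by (intro Pi_pmf_insert') auto
  \<comment> \<open>The insertion rule draws the new choice before the old ones; the draws are
    exchanged so that the chain after i steps comes out in front.\<close>
  also have "\<dots> = do {c \<leftarrow> Pi_pmf {1..i} 0 (nu g n); l \<leftarrow> nu g n (Suc i); return_pmf (c(Suc i := l))}"
    by (rule bind_commute_pmf)
  also have "map_pmf (\<lambda>c. chain m c (Suc i)) \<dots> =
      do {c \<leftarrow> Pi_pmf {1..i} 0 (nu g n); l \<leftarrow> nu g n (Suc i); return_pmf (chain m (c(Suc i := l)) (Suc i))}"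
    by (simp only: map_bind_pmf map_return_pmf)
  also have "\<dots> = do {c \<leftarrow> Pi_pmf {1..i} 0 (nu g n); l \<leftarrow> nu g n (Suc i);
      return_pmf (chain m c i - (if l \<le> chain m c i then 1 else 0))}"
  proof -
    have "chain m (c(Suc i := l)) i = chain m c i" for c l by (rule chain_cong) auto
    then show ?thesis by simp
  qed
  also have "\<dots> = bind_pmf (law n m i) (\<lambda>a. map_pmf (\<lambda>l. a - (if l \<le> a then 1 else 0)) (nu g n (Suc i)))"
    using restrict[of i] assms by (simp add: bind_map_pmf map_pmf_def bind_assoc_pmf bind_return_pmf)
  finally show ?thesis .
qed

text \<open>Since \<open>g\<close> is decreasing, the drift pushes the chain back towards the solution of the
  differential equation: errors do not amplify, and no Gronwall estimate is needed.\<close>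

lemma expectation_step:
  assumes i: "i < n" and a: "i + a \<le> n" and v: "0 \<le> v" "v \<le> 1"
    and \<delta>: "0 \<le> v' - v" "v' - v \<le> 1 / real n"
    and \<rho>: "\<bar>g v / g (real i / real n) / real n - (v' - v)\<bar> \<le> \<rho> / real n"
  shows "measure_pmf.expectation (nu g n (Suc i))
      (\<lambda>l. (real (Suc i + (a - (if l \<le> a then 1 else 0))) / real n - v')\<^sup>2) \<le>
    (real (i + a) / real n - v)\<^sup>2 + (2 * \<rho> / real n + 1 / (real n)\<^sup>2)"
proof -
  let ?p = "nu g n (Suc i)"
  define D where "D = real (i + a) / real n - v"
  define \<delta> where "\<delta> = v' - v"
  define q where "q = g (real (i + a) / real n) / g (real i / real n)"
  define h where "h = g v / g (real i / real n)"
  define e where "e = 1 / real n"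
  have n: "real n > 0" using i by simp
  have pos: "g (real i / real n) > 0" using i by (intro g_pos) auto
  have V01: "real (i + a) / real n \<le> 1" "real i / real n \<le> real (i + a) / real n"
    using a n by (auto simp: divide_le_eq_1 simp del: of_nat_add intro!: divide_right_mono)
  have q: "0 \<le> q" "q \<le> 1"
    unfolding q_def using pos V01 g_nonneg[of "real (i + a) / real n"]
      g_antimono[of "real i / real n" "real (i + a) / real n"] by (auto simp: divide_le_eq_1)
  \<comment> \<open>Dissipativity: D is the difference of (i + a) / n and v, and the decreasing g
    takes these two points to values in the opposite order.\<close>
  have "D * (q - h) \<le> 0"
  proof -
    have "D * (g (real (i + a) / real n) - g v) \<le> 0"
      unfolding D_def using g_antimono[of "real (i + a) / real n" v] g_antimono[of v "real (i + a) / real n"] V01 v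
      by (cases "real (i + a) / real n" v rule: linorder_cases)
        (auto simp: mult_le_0_iff simp del: of_nat_add)
    then have "D * (g (real (i + a) / real n) - g v) / g (real i / real n) \<le> 0"
      using pos by (simp add: divide_nonpos_pos)
    then show ?thesis by (simp add: q_def h_def diff_divide_distrib right_diff_distrib)
  qed
  moreover have "\<bar>D\<bar> \<le> 1"
  proof -
    have "0 \<le> real (i + a) / real n" by simp
    then show ?thesis unfolding D_def using V01 v by linarith
  qed
  moreover have "\<bar>h * e - \<delta>\<bar> \<le> \<rho> * e" using \<rho> by (simp add: h_def e_def \<delta>_def)
  moreover have "0 \<le> \<delta>" "\<delta> \<le> e" using assms(5,6) by (simp_all add: \<delta>_def e_def)
  ultimately have bound: "(D - \<delta>)\<^sup>2 + q * ((D - \<delta> + e)\<^sup>2 - (D - \<delta>)\<^sup>2) \<le> D\<^sup>2 + 2 * \<rho> * e + e\<^sup>2"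
    using q by (intro step_bound) auto
  have prob: "measure_pmf.prob ?p {a<..} = q"
  proof -
    have "measure_pmf.prob ?p (- {..a}) = 1 - measure_pmf.prob ?p {..a}"
      using measure_pmf.prob_compl[of "{..a}" ?p] by (simp add: Compl_eq_Diff_UNIV)
    moreover have "- {..a} = {a<..}" by auto
    ultimately show ?thesis using prob_nu_atMost[OF i, of a] a by (simp add: q_def)
  qed
  \<comment> \<open>The sum of time and chain is unchanged if the choice is at most a and grows by 1
    otherwise, so the square takes only the values at D - \<delta> and D - \<delta> + e.\<close>
  have "measure_pmf.expectation ?p (\<lambda>l. (real (Suc i + (a - (if l \<le> a then 1 else 0))) / real n - v')\<^sup>2) =
      measure_pmf.expectation ?p (\<lambda>l. (D - \<delta>)\<^sup>2 + ((D - \<delta> + e)\<^sup>2 - (D - \<delta>)\<^sup>2) * indicator {a<..} l)"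
  proof (rule integral_cong_AE)
    show "AE l in measure_pmf ?p. (real (Suc i + (a - (if l \<le> a then 1 else 0))) / real n - v')\<^sup>2 =
        (D - \<delta>)\<^sup>2 + ((D - \<delta> + e)\<^sup>2 - (D - \<delta>)\<^sup>2) * indicator {a<..} l"
    proof (rule AE_pmfI)
      fix l assume "l \<in> set_pmf ?p"
      then have l: "1 \<le> l" using set_nu[OF i] by auto
      show "(real (Suc i + (a - (if l \<le> a then 1 else 0))) / real n - v')\<^sup>2 =
        (D - \<delta>)\<^sup>2 + ((D - \<delta> + e)\<^sup>2 - (D - \<delta>)\<^sup>2) * indicator {a<..} l"
      proof (cases "l \<le> a")
        case True
        then have "Suc i + (a - 1) = i + a" using l by simp
        then show ?thesis using True by (simp add: D_def \<delta>_def)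
      next
        case False
        have "real (Suc i + a) / real n - v' = D - \<delta> + e"
          using n by (simp add: D_def \<delta>_def e_def add_divide_distrib)
        then show ?thesis using False by simp
      qed
    qed
  qed auto
  also have "\<dots> = (D - \<delta>)\<^sup>2 + ((D - \<delta> + e)\<^sup>2 - (D - \<delta>)\<^sup>2) * q"
    using prob by (subst Bochner_Integration.integral_add) (auto simp: measure_pmf.emeasure_eq_measure)
  also have "\<dots> \<le> D\<^sup>2 + 2 * \<rho> * e + e\<^sup>2" using bound by (simp add: mult.commute)
  finally show ?thesis by (simp add: D_def e_def power_divide)
qed

text \<open>The one-step bounds add up. The sequence v need only follow the equation up to \<rho> /
  n per step, and the initial term 1 / n^2 allows for starting from an integer m near n y.\<close>

lemma second_moment:
  assumes m: "m \<le> n" and v0: "\<bar>real m / real n - v 0\<bar> \<le> 1 / real n"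
    and v: "\<And>i. i \<le> j \<Longrightarrow> 0 \<le> v i \<and> v i \<le> 1"
    and \<delta>: "\<And>i. i < j \<Longrightarrow> 0 \<le> v (Suc i) - v i \<and> v (Suc i) - v i \<le> 1 / real n"
    and \<rho>: "\<And>i. i < j \<Longrightarrow>
      \<bar>g (v i) / g (real i / real n) / real n - (v (Suc i) - v i)\<bar> \<le> \<rho> / real n"
    and "i \<le> j" "j \<le> n"
  shows "measure_pmf.expectation (law n m i) (\<lambda>a. (real (i + a) / real n - v i)\<^sup>2) \<le>
    1 / (real n)\<^sup>2 + real i * (2 * \<rho> / real n + 1 / (real n)\<^sup>2)"
  using \<open>i \<le> j\<close>
proof (induction i)
  case 0
  have "law n m 0 = return_pmf m" by (simp add: law_def)
  moreover have "(real m / real n - v 0)\<^sup>2 \<le> (1 / real n)\<^sup>2"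
    using v0 by (metis abs_ge_zero power2_abs power_mono)
  ultimately show ?case by (simp add: power_divide)
next
  case (Suc i)
  define C where "C = 2 * \<rho> / real n + 1 / (real n)\<^sup>2"
  let ?f = "\<lambda>a. (real (i + a) / real n - v i)\<^sup>2"
  have i: "i < j" "i < n" using Suc.prems assms(7) by auto
  have sub: "set_pmf (law n m i) \<subseteq> {..m}" using set_law[OF m, of i] i by auto
  have fin: "finite (set_pmf (nu g n (Suc i)))" using set_nu[OF i(2)] by (rule finite_subset) simp
  have "measure_pmf.expectation (law n m (Suc i)) (\<lambda>a. (real (Suc i + a) / real n - v (Suc i))\<^sup>2) =
    (\<Sum>a\<le>m. pmf (law n m i) a * measure_pmf.expectation (nu g n (Suc i))
      (\<lambda>l. (real (Suc i + (a - (if l \<le> a then 1 else 0))) / real n - v (Suc i))\<^sup>2))"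
    unfolding law_Suc[OF i(2)] using sub fin by (subst pmf_expectation_bind[of "{..m}"]) auto
  also have "\<dots> \<le> (\<Sum>a\<le>m. pmf (law n m i) a * (?f a + C))"
  proof (rule sum_mono)
    fix a
    show "pmf (law n m i) a * measure_pmf.expectation (nu g n (Suc i))
      (\<lambda>l. (real (Suc i + (a - (if l \<le> a then 1 else 0))) / real n - v (Suc i))\<^sup>2) \<le>
        pmf (law n m i) a * (?f a + C)"
    proof (cases "a \<in> set_pmf (law n m i)")
      case True
      then have "i + a \<le> n" using set_law[OF m] i by auto
      then show ?thesis using i v[of i] \<delta>[of i] \<rho>[of i] 
        unfolding C_def by (intro mult_left_mono expectation_step) auto
    qed (simp add: set_pmf_iff)
  qed
  also have "\<dots> = (\<Sum>a\<le>m. pmf (law n m i) a * ?f a) + (\<Sum>a\<le>m. pmf (law n m i) a) * C"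
    by (simp add: distrib_left sum.distrib sum_distrib_right)
  also have "(\<Sum>a\<le>m. pmf (law n m i) a) = 1" by (rule sum_pmf_eq_1[OF _ sub]) simp
  also have "(\<Sum>a\<le>m. pmf (law n m i) a * ?f a) = measure_pmf.expectation (law n m i) ?f"
    using sub by (subst integral_measure_pmf[of "{..m}"]) auto
  finally have "measure_pmf.expectation (law n m (Suc i))
      (\<lambda>a. (real (Suc i + a) / real n - v (Suc i))\<^sup>2) \<le> measure_pmf.expectation (law n m i) ?f + C"
    by simp
  moreover have "measure_pmf.expectation (law n m i) ?f \<le> 1 / (real n)\<^sup>2 + real i * C"
    unfolding C_def using Suc by simp
  moreover have "real (Suc i) * C = real i * C + C" by (simp add: distrib_right)
  ultimately show ?case unfolding C_def[symmetric] by linarith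
qed

text \<open>Chebyshev's inequality applied to the second moment. The local error is small because
  \<open>H\<close> is uniformly continuous on [0, x], which uses x < 1.\<close>

lemma prob_chain_deviation:
  assumes y: "0 \<le> y" "y \<le> 1" and x: "0 \<le> x" "x < 1" and \<epsilon>: "\<epsilon> > 0" and \<gamma>: "\<gamma> > 0"
  shows "\<forall>\<^sub>F n in sequentially. measure_pmf.prob (choices n)
    {c. \<bar>real (nat \<lfloor>real n * x\<rfloor> + chain (nat \<lfloor>real n * y\<rfloor>) c (nat \<lfloor>real n * x\<rfloor>)) / real n
      - V (real (nat \<lfloor>real n * x\<rfloor>) / real n) y\<bar> > \<epsilon>} \<le> \<gamma>"
proof -
  \<comment> \<open>The second moment will be at most 2 / n + 2 \<rho>; with this \<rho> the second
    summand is half of the budget \<gamma> \<epsilon>^2, and the other half is left to 2 /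
    n.\<close>
  define \<rho> where "\<rho> = \<gamma> * \<epsilon>\<^sup>2 / 4"
  have \<rho>: "\<rho> > 0" using \<epsilon> \<gamma> by (simp add: \<rho>_def)
  have "uniformly_continuous_on {0..x} (\<lambda>s. H s y)"
    using H_cont[OF y x(2)] by (rule compact_uniformly_continuous) simp
  then obtain d where d: "d > 0" "\<And>s t. s \<in> {0..x} \<Longrightarrow> t \<in> {0..x} \<Longrightarrow> \<bar>s - t\<bar> < d \<Longrightarrow> \<bar>H s y - H t y\<bar> < \<rho>"
    unfolding uniformly_continuous_on_def using \<rho> by (metis dist_commute dist_real_def)
  have ev: "\<forall>\<^sub>F n in sequentially. n > 0 \<and> 1 / real n < d \<and> 2 / real n \<le> \<gamma> * \<epsilon>\<^sup>2 / 2"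
  proof (intro eventually_conj)
    show "\<forall>\<^sub>F n::nat in sequentially. n > 0" by (rule eventually_gt_at_top)
    show "\<forall>\<^sub>F n in sequentially. 1 / real n < d" using d(1) by real_asymp
    have "\<gamma> * \<epsilon>\<^sup>2 / 2 > 0" using \<epsilon> \<gamma> by simp
    then have "\<forall>\<^sub>F n in sequentially. 2 / real n < \<gamma> * \<epsilon>\<^sup>2 / 2"
      by (intro order_tendstoD(2)[of _ 0]) real_asymp
    then show "\<forall>\<^sub>F n in sequentially. 2 / real n \<le> \<gamma> * \<epsilon>\<^sup>2 / 2" by eventually_elim simp
  qed
  then show ?thesis
  proof eventually_elim
    case (elim n)
    then have n: "real n > 0" "1 / real n < d" "2 / real n \<le> \<gamma> * \<epsilon>\<^sup>2 / 2" by auto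
    define j where "j = nat \<lfloor>real n * x\<rfloor>"
    define m where "m = nat \<lfloor>real n * y\<rfloor>"
    define v where "v i = V (real i / real n) y" for i
    have jx: "real j \<le> real n * x" using n x by (simp add: j_def of_nat_nat)
    have mx: "real m \<le> real n * y" "real n * y < real m + 1" using n y by (simp_all add: m_def of_nat_nat)
    have "real n * x \<le> real n" using x by (intro mult_left_le) auto
    then have j_le: "j \<le> n" using jx by linarith
    have "real n * y \<le> real n" using y by (intro mult_left_le) auto
    then have m_le: "m \<le> n" using mx by linarith
    have in_x: "0 \<le> real i / real n" "real i / real n \<le> x" if "i \<le> j" for i
    proof -
      have "real i \<le> real n * x" using that jx by linarith
      then show "real i / real n \<le> x" using n by (simp add: divide_le_eq mult.commute)
    qed simp
    have mom: "measure_pmf.expectation (law n m j) (\<lambda>a. (real (j + a) / real n - v j)\<^sup>2) \<le>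
      1 / (real n)\<^sup>2 + real j * (2 * \<rho> / real n + 1 / (real n)\<^sup>2)"
    proof (rule second_moment[OF m_le])
      have "v 0 = y" using y by (simp add: v_def)
      moreover have "real m / real n - y = (real m - real n * y) / real n"
        using n(1) by (simp add: diff_divide_distrib)
      then have "\<bar>real m / real n - y\<bar> = \<bar>real m - real n * y\<bar> / real n"
        by simp
      ultimately show "\<bar>real m / real n - v 0\<bar> \<le> 1 / real n"
        using mx n by (simp add: divide_right_mono)
      show "0 \<le> v i \<and> v i \<le> 1" if "i \<le> j" for i
        using V_nonneg V_le_1 in_x[OF that] x y by (simp add: v_def)
      fix i assume i: "i < j"
      have si: "real (Suc i) / real n - real i / real n = 1 / real n" by (simp add: add_divide_distrib)
      have ix: "0 \<le> real i / real n" "real i / real n \<le> x" "real (Suc i) / real n \<le> x"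
        using in_x[of i] in_x[of "Suc i"] i by auto
      have lt: "real i / real n < real (Suc i) / real n" using si n by (metis diff_gt_0_iff_gt zero_less_divide_1_iff)
      show "0 \<le> v (Suc i) - v i \<and> v (Suc i) - v i \<le> 1 / real n"
        using V_lipschitz[of "real i / real n" "real (Suc i) / real n" y] lt ix x y si unfolding v_def by auto
      \<comment> \<open>The exact increment is H z y / n at an intermediate time z, the Euler
        increment is \<open>H\<close> at i / n divided by n. The two times differ by less than 1 /
        n, hence by less than d.\<close>
      obtain z where z: "real i / real n < z" "z < real (Suc i) / real n"
        "V (real (Suc i) / real n) y - V (real i / real n) y = (real (Suc i) / real n - real i / real n) * H z y"
        using V_mvt[OF ix(1) lt _ y] ix x by auto
      have "\<bar>H (real i / real n) y - H z y\<bar> < \<rho>"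
      proof (rule d(2))
        show "real i / real n \<in> {0..x}" "z \<in> {0..x}"
          unfolding atLeastAtMost_iff using z(1,2) ix by linarith+
        show "\<bar>real i / real n - z\<bar> < d" using z(1,2) si n(2) by linarith
      qed
      then have "\<bar>H (real i / real n) y / real n - H z y / real n\<bar> \<le> \<rho> / real n"
        unfolding diff_divide_distrib[symmetric] abs_divide using n by (simp add: divide_right_mono)
      then show "\<bar>g (v i) / g (real i / real n) / real n - (v (Suc i) - v i)\<bar> \<le> \<rho> / real n"
        using z(3) unfolding si v_def H_def by (simp add: mult.commute)
    qed (use j_le in auto)
    also have "\<dots> \<le> 1 / real n + real n * (2 * \<rho> / real n + 1 / (real n)\<^sup>2)"
    proof (intro add_mono mult_right_mono)
      have "1 \<le> real n" using n(1) by simp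
      then show "1 / (real n)\<^sup>2 \<le> 1 / real n" by (simp add: power2_eq_square field_simps)
    qed (use j_le \<rho> in auto)
    also have "\<dots> = 2 / real n + 2 * \<rho>" using n by (simp add: power2_eq_square field_simps)
    also have "\<dots> \<le> \<gamma> * \<epsilon>\<^sup>2" using n(3) by (simp add: \<rho>_def)
    finally have mom': "measure_pmf.expectation (law n m j) (\<lambda>a. (real (j + a) / real n - v j)\<^sup>2) \<le> \<gamma> * \<epsilon>\<^sup>2" .
    have sub: "set_pmf (law n m j) \<subseteq> {..m}" using set_law[OF m_le j_le] by auto
    then have fin: "finite (set_pmf (law n m j))" by (rule finite_subset) simp
    let ?B = "{a. \<bar>real (j + a) / real n - v j\<bar> > \<epsilon>}"
    have "measure_pmf.prob (law n m j) ?B * \<epsilon>\<^sup>2 = measure_pmf.expectation (law n m j) (\<lambda>a. \<epsilon>\<^sup>2 * indicator ?B a)"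
      by simp
    also have "\<dots> \<le> measure_pmf.expectation (law n m j) (\<lambda>a. (real (j + a) / real n - v j)\<^sup>2)"
    proof (rule integral_mono)
      fix a
      have "\<epsilon>\<^sup>2 \<le> (real (j + a) / real n - v j)\<^sup>2" if "a \<in> ?B"
      proof -
        have "\<epsilon>\<^sup>2 \<le> \<bar>real (j + a) / real n - v j\<bar>\<^sup>2" using that \<epsilon> by (intro power_mono) auto
        then show ?thesis by simp
      qed
      then show "\<epsilon>\<^sup>2 * indicator ?B a \<le> (real (j + a) / real n - v j)\<^sup>2"
        by (simp only: indicator_def of_bool_def) (cases "a \<in> ?B"; simp)
    qed (auto intro!: integrable_measure_pmf_finite fin)
    also note mom'
    finally have "measure_pmf.prob (law n m j) ?B \<le> \<gamma>" using \<epsilon> by simp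
    then show ?case
      unfolding law_def j_def m_def v_def by (simp add: vimage_def)
  qed
qed

lemma emp_cdf_eq:
  assumes c: "valid_choices n c" and x: "0 \<le> x" "x \<le> 1" and y: "0 \<le> y" "y \<le> 1"
  shows "emp_cdf n (perm_of_choices n c) x y =
    (real (nat \<lfloor>real n * y\<rfloor>) - real (chain (nat \<lfloor>real n * y\<rfloor>) c (nat \<lfloor>real n * x\<rfloor>))) / real n"
proof -
  define j where "j = nat \<lfloor>real n * x\<rfloor>"
  define m where "m = nat \<lfloor>real n * y\<rfloor>"
  have j: "i \<le> j \<longleftrightarrow> real i \<le> real n * x" and m: "i \<le> m \<longleftrightarrow> real i \<le> real n * y" for i
    using x y unfolding j_def m_def by (simp_all add: le_nat_iff le_floor_iff)
  have le: "j \<le> n" "m \<le> n"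
    using j[of j] m[of m] x y mult_left_le[of x "real n"] mult_left_le[of y "real n"] by auto
  have "{i \<in> {1..n}. real i \<le> real n * x \<and> real (perm_of_choices n c i) \<le> real n * y} =
      {i \<in> {1..j}. perm_of_choices n c i \<le> m}"
  proof -
    have "i \<in> {1..n} \<and> real i \<le> real n * x \<longleftrightarrow> i \<in> {1..j}" for i
      unfolding j[symmetric] using le(1) by auto
    then show ?thesis unfolding m[symmetric] by blast
  qed
  moreover have "real (card {i \<in> {1..j}. perm_of_choices n c i \<le> m}) = real m - real (chain m c j)"
    using card_small_values[OF c le(2,1)] by linarith
  ultimately show ?thesis unfolding emp_cdf_def j_def m_def by simp
qed

lemma emp_cdf_tendsto:
  assumes x: "0 \<le> x" "x \<le> 1" and y: "0 \<le> y" "y \<le> 1" and \<epsilon>: "\<epsilon> > 0"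
  shows "(\<lambda>n. measure_pmf.prob (PERM g n) {\<sigma>. \<bar>emp_cdf n \<sigma> x y - F_fun g x y\<bar> > \<epsilon>}) \<longlonglongrightarrow> 0"
proof (rule tendstoI)
  fix \<gamma>' :: real assume "\<gamma>' > 0"
  define \<gamma> where "\<gamma> = \<gamma>' / 2"
  have \<gamma>: "\<gamma> > 0" "\<gamma> < \<gamma>'" using \<open>\<gamma>' > 0\<close> by (auto simp: \<gamma>_def)
  let ?j = "\<lambda>n. nat \<lfloor>real n * x\<rfloor>" and ?m = "\<lambda>n. nat \<lfloor>real n * y\<rfloor>"
  let ?dev = "\<lambda>n. {c. \<bar>real (?j n + chain (?m n) c (?j n)) / real n - V (real (?j n) / real n) y\<bar> > \<epsilon> / 2}"
  have dev: "\<forall>\<^sub>F n in sequentially. measure_pmf.prob (choices n) (?dev n) \<le> \<gamma>"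
  proof (cases "x = 1")
    case True
    \<comment> \<open>After n steps nothing remains, so the chain is 0; also V 1 y = 1, and the
      deviation vanishes.\<close>
    have "measure_pmf.prob (choices n) (?dev n) \<le> \<gamma>" if "n > 0" for n
    proof -
      have "?m n \<le> n" using y mult_left_le[of y "real n"] by linarith
      then have "chain (?m n) c n = 0" if "c \<in> set_pmf (choices n)" for c
        using chain_le[OF choices_valid[OF that], of "?m n" n] by simp
      then have "set_pmf (choices n) \<inter> ?dev n = {}" using True \<epsilon> \<open>n > 0\<close> by auto
      then have "measure_pmf.prob (choices n) (?dev n) = 0" by (simp add: measure_pmf_zero_iff)
      then show ?thesis using \<gamma> by simp
    qed
    then show ?thesis using eventually_gt_at_top[of 0] by (rule eventually_mono[rotated]) 
  next
    case False
    then show ?thesis using prob_chain_deviation[OF y, of x "\<epsilon> / 2" \<gamma>] x \<epsilon> \<gamma> by simp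
  qed
  \<comment> \<open>Three rounding errors of at most 1 / n each: x to j / n, y to m / n, and the
    resulting change of V in its first argument.\<close>
  have "\<forall>\<^sub>F n in sequentially. 3 / real n < \<epsilon> / 2"
    using \<epsilon> by (intro order_tendstoD(2)[of _ 0]) (real_asymp, simp)
  with dev eventually_gt_at_top[of 0]
  show "\<forall>\<^sub>F n in sequentially. dist (measure_pmf.prob (PERM g n)
      {\<sigma>. \<bar>emp_cdf n \<sigma> x y - F_fun g x y\<bar> > \<epsilon>}) 0 < \<gamma>'"
  proof eventually_elim
    case (elim n)
    then have n: "real n > 0" "3 / real n < \<epsilon> / 2" by auto
    have "measure_pmf.prob (PERM g n) {\<sigma>. \<bar>emp_cdf n \<sigma> x y - F_fun g x y\<bar> > \<epsilon>} =
        measure_pmf.prob (choices n) {c. \<bar>emp_cdf n (perm_of_choices n c) x y - F_fun g x y\<bar> > \<epsilon>}"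
      unfolding PERM_def by (simp add: vimage_def)
    also have "\<dots> \<le> measure_pmf.prob (choices n) (?dev n)"
    proof (rule measure_pmf.finite_measure_mono_AE)
      show "AE c in measure_pmf (choices n). c \<in> {c. \<bar>emp_cdf n (perm_of_choices n c) x y - F_fun g x y\<bar> > \<epsilon>} \<longrightarrow> c \<in> ?dev n"
      proof (rule AE_pmfI, rule impI)
        fix c assume c: "c \<in> set_pmf (choices n)" and
          big: "c \<in> {c. \<bar>emp_cdf n (perm_of_choices n c) x y - F_fun g x y\<bar> > \<epsilon>}"
        define j where "j = ?j n"
        define m where "m = ?m n"
        define X where "X = real j / real n"
        define Y where "Y = real m / real n"
        define A where "A = real (chain m c j) / real n"
        have jx: "real j \<le> real n * x" "real n * x < real j + 1" using n x by (simp_all add: j_def of_nat_nat)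
        have mx: "real m \<le> real n * y" "real n * y < real m + 1" using n y by (simp_all add: m_def of_nat_nat)
        have X: "0 \<le> X" "X \<le> x" "x \<le> X + 1 / real n"
          using jx n by (auto simp: X_def field_simps)
        have Y: "Y \<le> y" "y \<le> Y + 1 / real n"
          using mx n by (auto simp: Y_def field_simps)
        have V: "V X y \<le> V x y" "V x y - V X y \<le> x - X"
          using V_lipschitz[of X x y] X x y by auto
        have "emp_cdf n (perm_of_choices n c) x y = Y - A"
          using emp_cdf_eq[OF choices_valid[OF c] x y] by (simp add: Y_def A_def m_def j_def diff_divide_distrib)
        then have "\<bar>Y - A - (x + y - V x y)\<bar> > \<epsilon>" using big by (simp add: F_fun_def)
        then have "\<bar>X + A - V X y\<bar> > \<epsilon> / 2" using X Y V n(2) by linarith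
        then show "c \<in> ?dev n" by (simp add: X_def A_def j_def m_def add_divide_distrib)
      qed
    qed auto
    also have "\<dots> \<le> \<gamma>" using elim by simp
    finally show ?case using \<gamma> by (simp add: dist_real_def)
  qed
qed

end

subsection \<open>The empirical measure of a permutation\<close>

text \<open>An interval of length 1 / N contains at most n / N + 1 multiples of 1 / n.\<close>

lemma card_grid_cell:
  assumes n: "n > 0"
  shows "real (card {i \<in> {1..n}. real i / real n \<in> grid_cell N r}) \<le> real n * (1 / real N + 1 / real n)"
proof -
  define a where "a = nat \<lfloor>real n * (real r / real N)\<rfloor>"
  define b where "b = nat \<lfloor>real n * (real (Suc r) / real N)\<rfloor>"
  have le: "real n * (real r / real N) \<le> real n * (real (Suc r) / real N)"
    by (intro mult_left_mono divide_right_mono) auto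
  have fl: "real a \<le> real n * (real r / real N)" "real n * (real r / real N) < real a + 1"
    "real b \<le> real n * (real (Suc r) / real N)"
    unfolding a_def b_def by (simp_all add: of_nat_nat)
  have ab: "a \<le> b" unfolding a_def b_def using le by (intro nat_mono floor_mono)
  have "{i \<in> {1..n}. real i / real n \<in> grid_cell N r} \<subseteq> {a<..b}"
  proof
    fix i assume "i \<in> {i \<in> {1..n}. real i / real n \<in> grid_cell N r}"
    then have "real r / real N < real i / real n" "real i / real n \<le> real (Suc r) / real N"
      by (auto simp: grid_cell_def)
    then have "real n * (real r / real N) < real i" "real i \<le> real n * (real (Suc r) / real N)"
      using n by (simp_all add: less_divide_eq divide_le_eq mult.commute del: of_nat_Suc)
    then show "i \<in> {a<..b}" using fl unfolding b_def greaterThanAtMost_iff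
      by (intro conjI) (linarith, simp add: le_nat_iff le_floor_iff)
  qed
  then have "card {i \<in> {1..n}. real i / real n \<in> grid_cell N r} \<le> b - a"
    using card_mono[of "{a<..b}"] by simp
  then have "real (card {i \<in> {1..n}. real i / real n \<in> grid_cell N r}) \<le> real (b - a)"
    by (simp only: of_nat_le_iff)
  also have "\<dots> = real b - real a" using ab by (rule of_nat_diff)
  also have "\<dots> \<le> real n * (real (Suc r) / real N) - real n * (real r / real N) + 1" using fl by linarith
  also have "\<dots> = real n * (1 / real N + 1 / real n)"
    using n by (simp add: add_divide_distrib distrib_left)
  finally show ?thesis .
qed

lemma empirical_square_point:
  assumes n: "n > 0" and bij: "bij_betw \<sigma> {1..n} {1..n}"
  shows "square_point (uniform_count_measure {1..n}) (\<lambda>i. real i / real n) (\<lambda>i. real (\<sigma> i) / real n)"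
proof -
  have "prob_space (uniform_count_measure {1..n})"
    using n by (intro prob_space_uniform_count_measure) auto
  then interpret prob_space "uniform_count_measure {1..n}" .
  have meas: "f \<in> borel_measurable (uniform_count_measure {1..n})" for f :: "nat \<Rightarrow> real"
    by (simp add: measurable_cong_sets[OF sets_uniform_count_measure_count_space refl])
  have unit: "real i / real n \<in> {0<..1}" if "i \<in> {1..n}" for i
    using that n by (simp add: divide_le_eq)
  have sp: "space (uniform_count_measure {1..n}) = {1..n}" by (rule space_uniform_count_measure)
  show ?thesis
  proof unfold_locales
    show "AE s in uniform_count_measure {1..n}. real s / real n \<in> {0<..1}"
      using unit by (intro AE_I2) (simp only: sp)
    show "AE s in uniform_count_measure {1..n}. real (\<sigma> s) / real n \<in> {0<..1}"
      using unit bij_betwE[OF bij] by (intro AE_I2) (simp only: sp)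
  qed (rule meas)+
qed

lemma measure_uniform_count:
  assumes "finite A" "B \<subseteq> A"
  shows "measure (uniform_count_measure A) B = real (card B) / real (card A)"
  using assms by (simp add: measure_uniform_count_measure)

lemma measure_uniform_count_Collect:
  "measure (uniform_count_measure {1..n}) {i \<in> {1..n}. P i} = real (card {i \<in> {1..n}. P i}) / real n"
  by (rule trans[OF measure_uniform_count]) auto

text \<open>The bijection \<sigma> maps the positions whose value lies in row r onto the positions
  that lie in column r, so rows and columns carry the same counts.\<close>

lemma empirical_cell_bounds:
  assumes n: "n > 0" and bij: "bij_betw \<sigma> {1..n} {1..n}"
  defines "M \<equiv> uniform_count_measure {1..n}"
  shows "measure M {s \<in> space M. real s / real n \<in> grid_cell N r} \<le> 1 / real N + 1 / real n"
    and "measure M {s \<in> space M. real (\<sigma> s) / real n \<in> grid_cell N r} \<le> 1 / real N + 1 / real n"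
proof -
  let ?A = "{i \<in> {1..n}. real i / real n \<in> grid_cell N r}"
  let ?B = "{i \<in> {1..n}. real (\<sigma> i) / real n \<in> grid_cell N r}"
  have "\<sigma> ` ?B = ?A"
  proof
    show "\<sigma> ` ?B \<subseteq> ?A" using bij_betwE[OF bij] by blast
    show "?A \<subseteq> \<sigma> ` ?B"
    proof
      fix v assume v: "v \<in> ?A"
      then obtain i where "i \<in> {1..n}" "v = \<sigma> i" using bij_betw_imp_surj_on[OF bij] by blast
      then show "v \<in> \<sigma> ` ?B" using v by blast
    qed
  qed
  moreover have "inj_on \<sigma> ?B" by (rule inj_on_subset[OF bij_betw_imp_inj_on[OF bij]]) blast
  ultimately have "card ?B = card ?A" using card_image by fastforce
  moreover have "real (card ?A) / real n \<le> 1 / real N + 1 / real n"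
    using card_grid_cell[OF n] n by (simp add: divide_le_eq mult.commute)
  moreover have "measure M ?A = real (card ?A) / real n" "measure M ?B = real (card ?B) / real n"
    unfolding M_def by (rule measure_uniform_count_Collect)+
  ultimately show "measure M {s \<in> space M. real s / real n \<in> grid_cell N r} \<le> 1 / real N + 1 / real n"
    and "measure M {s \<in> space M. real (\<sigma> s) / real n \<in> grid_cell N r} \<le> 1 / real N + 1 / real n"
    unfolding M_def space_uniform_count_measure by simp_all
qed

lemma empirical_cdf2:
  assumes n: "n > 0" and bij: "bij_betw \<sigma> {1..n} {1..n}"
  shows "square_point.cdf2 (uniform_count_measure {1..n}) (\<lambda>i. real i / real n) (\<lambda>i. real (\<sigma> i) / real n) x y
    = emp_cdf n \<sigma> x y"
proof -
  interpret square_point "uniform_count_measure {1..n}" "\<lambda>i. real i / real n" "\<lambda>i. real (\<sigma> i) / real n"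
    by (rule empirical_square_point[OF assms])
  show ?thesis
    unfolding cdf2_def emp_cdf_def space_uniform_count_measure measure_uniform_count_Collect
    using n by (simp add: divide_le_eq mult.commute)
qed

section \<open>Pattern counts as probabilities for sampling with replacement\<close>

definition pattern_tuples :: "nat \<Rightarrow> (nat \<Rightarrow> nat) \<Rightarrow> nat \<Rightarrow> (nat \<Rightarrow> nat) \<Rightarrow> (nat \<Rightarrow> nat) set" where
  "pattern_tuples k \<tau> n \<sigma> = {i \<in> increasing_tuples k n.
     \<forall>a\<in>{1..k}. \<forall>b\<in>{1..k}. \<sigma> (i a) < \<sigma> (i b) \<longleftrightarrow> \<tau> a < \<tau> b}"

lemma finite_increasing_tuples: "finite (increasing_tuples k n)"
proof (rule finite_subset)
  show "increasing_tuples k n \<subseteq> {1..k} \<rightarrow>\<^sub>E {1..n}" unfolding increasing_tuples_def by blast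
  show "finite ({1..k} \<rightarrow>\<^sub>E {1..n})" by (intro finite_PiE) auto
qed

text \<open>Every k-tuple of indices has mass n^(-k). Tuples with repeated indices do not count,
  because the positions have to increase strictly.\<close>

lemma empirical_ordered_pattern:
  assumes n: "n > 0" and bij: "bij_betw \<sigma> {1..n} {1..n}"
  shows "measure (Pi\<^sub>M {1..k} (\<lambda>_. uniform_count_measure {1..n}))
     (square_point.ordered_pattern (uniform_count_measure {1..n}) (\<lambda>i. real i / real n)
        (\<lambda>i. real (\<sigma> i) / real n) k \<tau>) = real (card (pattern_tuples k \<tau> n \<sigma>)) / real n ^ k"
proof -
  let ?M = "uniform_count_measure {1..n}"
  interpret square_point ?M "\<lambda>i. real i / real n" "\<lambda>i. real (\<sigma> i) / real n"
    by (rule empirical_square_point[OF assms])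
  interpret I: prob_space "iid k" by (rule prob_space_iid)
  have lt: "real a / real n < real b / real n \<longleftrightarrow> a < b" for a b
    using n by (simp add: divide_less_cancel)
  have eq: "ordered_pattern k \<tau> = pattern_tuples k \<tau> n \<sigma>"
    unfolding ordered_pattern_def pattern_tuples_def increasing_tuples_def space_PiM
      space_uniform_count_measure lt strict_mono_on_def by blast
  have fin: "finite (pattern_tuples k \<tau> n \<sigma>)"
    unfolding pattern_tuples_def using finite_increasing_tuples by simp
  have single: "{p} \<in> I.events \<and> I.prob {p} = (1 / real n) ^ k" if p: "p \<in> pattern_tuples k \<tau> n \<sigma>" for p
  proof -
    have pPi: "p \<in> {1..k} \<rightarrow>\<^sub>E {1..n}" using p unfolding pattern_tuples_def increasing_tuples_def by blast
    then have mem: "p j \<in> {1..n}" if "j \<in> {1..k}" for j using that by blast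
    have "p \<in> extensional {1..k}" using pPi by (simp add: PiE_iff)
    then have box: "{p} = (\<Pi>\<^sub>E j\<in>{1..k}. {p j})" by (rule PiE_singleton[symmetric])
    have sing: "{p j} \<in> sets ?M" if "j \<in> {1..k}" for j
      using mem[OF that] by (simp add: sets_uniform_count_measure)
    have "I.prob (\<Pi>\<^sub>E j\<in>{1..k}. {p j}) = (\<Prod>j\<in>{1..k}. prob {p j})"
      by (rule measure_iid_box[OF sing])
    also have "\<dots> = (\<Prod>j\<in>{1..k}. 1 / real n)"
    proof (rule prod.cong[OF refl])
      fix j assume "j \<in> {1..k}"
      then have "{p j} \<subseteq> {1..n}" using mem by blast
      then show "prob {p j} = 1 / real n" by (subst measure_uniform_count) auto
    qed
    also have "\<dots> = (1 / real n) ^ k" by simp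
    finally have "I.prob {p} = (1 / real n) ^ k" unfolding box .
    moreover have "(\<Pi>\<^sub>E j\<in>{1..k}. {p j}) \<in> I.events" using sing by (intro sets_PiM_I_finite) auto
    ultimately show ?thesis unfolding box[symmetric] by blast
  qed
  have "I.prob (pattern_tuples k \<tau> n \<sigma>) = (\<Sum>p\<in>pattern_tuples k \<tau> n \<sigma>. I.prob {p})"
    using single by (intro I.finite_measure_eq_sum_singleton fin) blast
  also have "\<dots> = (\<Sum>p\<in>pattern_tuples k \<tau> n \<sigma>. (1 / real n) ^ k)"
    using single by (intro sum.cong) blast+
  finally show ?thesis unfolding eq by (simp add: power_divide)
qed

text \<open>An increasing tuple is the sorted list of its range; the shift j - 1 reconciles labels
  that start at 1 with list positions that start at 0.\<close>

lemma card_increasing_tuples: "card (increasing_tuples k n) = n choose k"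
proof -
  let ?S = "{A. A \<subseteq> {1..n} \<and> card A = k}"
  define f where "f A = (\<lambda>j\<in>{1..k}. sorted_list_of_set A ! (j - 1))" for A :: "nat set"
  have "bij_betw f ?S (increasing_tuples k n)"
  proof (rule bij_betw_byWitness[where f' = "\<lambda>i. i ` {1..k}"])
    have img: "f A ` {1..k} = A" "f A \<in> increasing_tuples k n" if "A \<in> ?S" for A
    proof -
      have A: "A \<subseteq> {1..n}" "card A = k" "finite A" using that finite_subset by auto
      define xs where "xs = sorted_list_of_set A"
      have xs: "set xs = A" "length xs = k" "sorted_wrt (<) xs" using A by (simp_all add: xs_def)
      have fj: "f A j = xs ! (j - 1)" if "j \<in> {1..k}" for j using that by (simp add: f_def xs_def)
      have "f A ` {1..k} = (\<lambda>j. xs ! (j - 1)) ` {1..k}" using fj by (intro image_cong) auto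
      also have "\<dots> = (!) xs ` ((\<lambda>j. j - 1) ` {1..k})" by (simp add: image_image)
      also have "(\<lambda>j. j - 1) ` {1..k} = {..<k}"
        by (auto simp: image_iff intro!: bexI[of _ "Suc _"])
      also have "(!) xs ` {..<k} = A" using xs by (auto simp: set_conv_nth image_iff)
      finally show im: "f A ` {1..k} = A" .
      show "f A \<in> increasing_tuples k n"
        unfolding increasing_tuples_def
      proof (intro CollectI conjI)
        show "f A \<in> {1..k} \<rightarrow>\<^sub>E {1..n}" using im A(1) unfolding f_def by (auto simp del: atLeastAtMost_iff)
        show "strict_mono_on {1..k} (f A)"
        proof (rule strict_mono_onI)
          fix a b assume ab: "a \<in> {1..k}" "b \<in> {1..k}" "a < b"
          then have "xs ! (a - 1) < xs ! (b - 1)"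
            using xs(2) by (intro sorted_wrt_nth_less[OF xs(3)]) auto
          then show "f A a < f A b" using fj ab by simp
        qed
      qed
    qed
    show "\<forall>A\<in>?S. f A ` {1..k} = A" using img by blast
    show "f ` ?S \<subseteq> increasing_tuples k n" using img by blast
    have inv: "i ` {1..k} \<in> ?S" "f (i ` {1..k}) = i" if i: "i \<in> increasing_tuples k n" for i
    proof -
      have mono: "strict_mono_on {1..k} i" and Pi: "i \<in> {1..k} \<rightarrow>\<^sub>E {1..n}"
        using i by (simp_all add: increasing_tuples_def)
      have "inj_on i {1..k}" using mono by (rule strict_mono_on_imp_inj_on)
      then have card: "card (i ` {1..k}) = k" by (simp add: card_image)
      then show "i ` {1..k} \<in> ?S" using Pi by blast
      define ys where "ys = map i [1..<Suc k]"
      have "sorted_wrt (<) ys"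
        unfolding ys_def sorted_wrt_map
        by (rule sorted_wrt_mono_rel[OF _ sorted_wrt_upt]) (auto intro!: strict_mono_onD[OF mono])
      moreover have "set ys = i ` {1..k}" unfolding ys_def by (simp add: atLeastLessThanSuc_atLeastAtMost del: upt_Suc)
      ultimately have "sorted_list_of_set (i ` {1..k}) = ys"
        by (metis sorted_list_of_set.idem_if_sorted_distinct strict_sorted_iff)
      moreover have "ys ! (j - 1) = i j" if "j \<in> {1..k}" for j
        using that unfolding ys_def by (subst nth_map_upt) auto
      ultimately show "f (i ` {1..k}) = i"
        unfolding f_def using Pi by (auto simp: PiE_iff extensional_def fun_eq_iff)
    qed
    show "\<forall>i\<in>increasing_tuples k n. f (i ` {1..k}) = i" using inv by blast
    show "(\<lambda>i. i ` {1..k}) ` increasing_tuples k n \<subseteq> ?S" using inv(1) by blast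
  qed
  then have "card (increasing_tuples k n) = card ?S" by (metis bij_betw_same_card)
  also have "\<dots> = n choose k" by (subst n_subsets) auto
  finally show ?thesis .
qed

text \<open>Converts the normalisation n^k of sampling with replacement into the number of
  increasing tuples, which is n^k / k! times a product of k factors 1 - i / n.\<close>

lemma power_over_binomial_tendsto: "(\<lambda>n. real n ^ k / real (n choose k)) \<longlonglongrightarrow> fact k"
proof -
  have "(\<lambda>n. (\<Prod>i = 0..<k. 1 - real i / real n) / fact k) \<longlonglongrightarrow> (\<Prod>i = 0..<k. 1 - 0) / fact k"
    by (intro tendsto_divide tendsto_prod tendsto_diff tendsto_const lim_const_over_n) simp
  then have lim: "(\<lambda>n. inverse ((\<Prod>i = 0..<k. 1 - real i / real n) / fact k)) \<longlonglongrightarrow> inverse (1 / fact k)"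
    by (intro tendsto_inverse) simp_all
  have "\<forall>\<^sub>F n in sequentially. inverse ((\<Prod>i = 0..<k. 1 - real i / real n) / fact k) =
      real n ^ k / real (n choose k)"
    using eventually_gt_at_top[of 0]
  proof eventually_elim
    case (elim n)
    have "real (n choose k) = (\<Prod>i = 0..<k. real n - real i) / fact k"
      by (simp add: binomial_gbinomial gbinomial_prod_rev)
    also have "(\<Prod>i = 0..<k. real n - real i) = (\<Prod>i = 0..<k. real n * (1 - real i / real n))"
      using elim by (intro prod.cong) (auto simp: right_diff_distrib)
    also have "\<dots> = real n ^ k * (\<Prod>i = 0..<k. 1 - real i / real n)" by (simp add: prod.distrib)
    finally have binom: "real (n choose k) = real n ^ k * (\<Prod>i = 0..<k. 1 - real i / real n) / fact k" .
    have "inverse (P / fact k) = real n ^ k / (real n ^ k * P / fact k)" for P :: real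
      using elim by simp
    then show ?case unfolding binom .
  qed
  then show ?thesis using Lim_transform_eventually[OF lim] by simp
qed

subsection \<open>Comparison of two square points\<close>

text \<open>The four corners give 4 \<eta> per cell, and two products of k numbers in [0, 1] differ
  by at most the sum of the differences of their factors. The number of placements is large but
  depends only on N, k and \<tau>.\<close>

lemma cell_sum_diff:
  assumes M: "square_point M X Y" and M': "square_point M' X' Y'" and N: "N > 0"
    and \<eta>: "\<And>a b. a \<le> N \<Longrightarrow> b \<le> N \<Longrightarrow>
      \<bar>square_point.cdf2 M X Y (real a / N) (real b / N) - square_point.cdf2 M' X' Y' (real a / N) (real b / N)\<bar> \<le> \<eta>"
  shows "\<bar>(\<Sum>c\<in>pattern_cells k \<tau> N. \<Prod>j\<in>{1..k}. square_point.cell_prob M X Y N (c j)) -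
      (\<Sum>c\<in>pattern_cells k \<tau> N. \<Prod>j\<in>{1..k}. square_point.cell_prob M' X' Y' N (c j))\<bar>
    \<le> real (card (pattern_cells k \<tau> N)) * (real k * (4 * \<eta>))"
proof -
  interpret A: square_point M X Y by (rule M)
  interpret B: square_point M' X' Y' by (rule M')
  have cell: "\<bar>A.cell_prob N (a, b) - B.cell_prob N (a, b)\<bar> \<le> 4 * \<eta>" if "a < N" "b < N" for a b
    unfolding A.cell_prob_cdf2[OF N] B.cell_prob_cdf2[OF N]
    using \<eta>[of a b] \<eta>[of "Suc a" b] \<eta>[of a "Suc b"] \<eta>[of "Suc a" "Suc b"] that by linarith
  have prod: "\<bar>(\<Prod>j\<in>{1..k}. A.cell_prob N (c j)) - (\<Prod>j\<in>{1..k}. B.cell_prob N (c j))\<bar> \<le> real k * (4 * \<eta>)"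
    if c: "c \<in> pattern_cells k \<tau> N" for c
  proof -
    have "norm ((\<Prod>j\<in>{1..k}. A.cell_prob N (c j)) - (\<Prod>j\<in>{1..k}. B.cell_prob N (c j))) \<le>
        (\<Sum>j\<in>{1..k}. norm (A.cell_prob N (c j) - B.cell_prob N (c j)))"
      by (rule norm_prod_diff) (auto simp: A.cell_prob_def B.cell_prob_def)
    also have "\<dots> \<le> (\<Sum>j\<in>{1..k}. 4 * \<eta>)"
    proof (rule sum_mono)
      fix j assume "j \<in> {1..k}"
      then have "c j \<in> {..<N} \<times> {..<N}" using c unfolding pattern_cells_def by blast
      then show "norm (A.cell_prob N (c j) - B.cell_prob N (c j)) \<le> 4 * \<eta>"
        using cell by (cases "c j") auto
    qed
    finally show ?thesis by simp
  qed
  have "\<bar>(\<Sum>c\<in>pattern_cells k \<tau> N. \<Prod>j\<in>{1..k}. A.cell_prob N (c j)) -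
      (\<Sum>c\<in>pattern_cells k \<tau> N. \<Prod>j\<in>{1..k}. B.cell_prob N (c j))\<bar> \<le>
    (\<Sum>c\<in>pattern_cells k \<tau> N. real k * (4 * \<eta>))"
    unfolding sum_subtractf[symmetric] using prod by (intro order.trans[OF sum_abs] sum_mono)
  then show ?thesis by simp
qed

section \<open>Empirical and limiting densities on the same grid\<close>

context profile
begin

definition limit_density :: "nat \<Rightarrow> (nat \<Rightarrow> nat) \<Rightarrow> real" where
  "limit_density k \<tau> = measure (Pi\<^sub>M {1..k} (\<lambda>_. mu_g)) (square_point.ordered_pattern mu_g fst snd k \<tau>)"

lemma permuton_pattern_density_eq:
  assumes "\<tau> permutes {1..k}"
  shows "permuton_pattern_density k \<tau> (mu_perm g) = fact k * limit_density k \<tau>"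
proof -
  interpret square_point mu_g fst snd by (rule permuton_square_point(1)[OF permuton_mu_g])
  have "permuton_pattern_density k \<tau> (mu_perm g) = measure (iid k) (rank_pattern k \<tau>)"
    unfolding permuton_pattern_density_def mu_perm_eq rank_pattern_def ..
  also have "\<dots> = fact k * measure (iid k) (ordered_pattern k \<tau>)"
    using permuton_square_point(2)[OF permuton_mu_g] by (intro measure_rank_pattern assms) auto
  finally show ?thesis by (simp add: limit_density_def)
qed

lemma mu_g_cdf2:
  assumes "x \<in> {0..1}" "y \<in> {0..1}"
  shows "square_point.cdf2 mu_g fst snd x y = F_fun g x y"
proof -
  interpret square_point mu_g fst snd by (rule permuton_square_point(1)[OF permuton_mu_g])
  have "space mu_g = UNIV" by (simp add: mu_g_def)
  then have "{s \<in> space mu_g. fst s \<le> x \<and> snd s \<le> y} = {..x} \<times> {..y}" by auto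
  then show ?thesis unfolding cdf2_def using mu_g_cdf[OF assms] by simp
qed

text \<open>Triangle inequality through the two cell sums. The term 2 / N + 1 / n adds the largest
  row or column mass 1 / N + 1 / n of the permutation to the mass 1 / N of the permuton.\<close>

lemma count_vs_limit:
  assumes \<tau>: "\<tau> permutes {1..k}" and n: "n > 0" and N: "N > 0" and bij: "bij_betw \<sigma> {1..n} {1..n}"
    and \<eta>: "\<And>a b. a \<le> N \<Longrightarrow> b \<le> N \<Longrightarrow>
      \<bar>emp_cdf n \<sigma> (real a / N) (real b / N) - F_fun g (real a / N) (real b / N)\<bar> \<le> \<eta>"
  shows "\<bar>real (card (pattern_tuples k \<tau> n \<sigma>)) / real n ^ k - limit_density k \<tau>\<bar> \<le>
    2 * real (k\<^sup>2) * (2 / real N + 1 / real n) + real (card (pattern_cells k \<tau> N)) * (real k * (4 * \<eta>))"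
proof -
  let ?M = "uniform_count_measure {1..n}"
  interpret E: square_point ?M "\<lambda>i. real i / real n" "\<lambda>i. real (\<sigma> i) / real n"
    by (rule empirical_square_point[OF n bij])
  interpret G: square_point mu_g fst snd by (rule permuton_square_point(1)[OF permuton_mu_g])
  have inj: "inj_on \<tau> {1..k}" using \<tau> by (rule permutes_inj_on)
  have e: "\<bar>real (card (pattern_tuples k \<tau> n \<sigma>)) / real n ^ k -
      (\<Sum>c\<in>pattern_cells k \<tau> N. \<Prod>j\<in>{1..k}. E.cell_prob N (c j))\<bar> \<le> 2 * real (k\<^sup>2) * (1 / real N + 1 / real n)"
    unfolding empirical_ordered_pattern[OF n bij, symmetric]
    using empirical_cell_bounds[OF n bij] by (intro E.ordered_pattern_approx inj N) auto
  have g: "\<bar>limit_density k \<tau> - (\<Sum>c\<in>pattern_cells k \<tau> N. \<Prod>j\<in>{1..k}. G.cell_prob N (c j))\<bar> \<le>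
      2 * real (k\<^sup>2) * (1 / real N)"
    unfolding limit_density_def
    using permuton_square_point(2,3)[OF permuton_mu_g] by (intro G.ordered_pattern_approx inj N) auto
  have d: "\<bar>(\<Sum>c\<in>pattern_cells k \<tau> N. \<Prod>j\<in>{1..k}. E.cell_prob N (c j)) -
      (\<Sum>c\<in>pattern_cells k \<tau> N. \<Prod>j\<in>{1..k}. G.cell_prob N (c j))\<bar>
    \<le> real (card (pattern_cells k \<tau> N)) * (real k * (4 * \<eta>))"
  proof (rule cell_sum_diff[OF E.square_point_axioms G.square_point_axioms N])
    fix a b assume ab: "a \<le> N" "b \<le> N"
    then have "real a / N \<in> {0..1}" "real b / N \<in> {0..1}" using N by (auto simp: divide_le_eq)
    then show "\<bar>E.cdf2 (real a / N) (real b / N) - G.cdf2 (real a / N) (real b / N)\<bar> \<le> \<eta>"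
      using \<eta>[OF ab] by (simp only: empirical_cdf2[OF n bij] mu_g_cdf2)
  qed
  have "2 * real (k\<^sup>2) * (2 / real N + 1 / real n) =
      2 * real (k\<^sup>2) * (1 / real N + 1 / real n) + 2 * real (k\<^sup>2) * (1 / real N)"
    unfolding distrib_left[symmetric] by simp
  then show ?thesis using e g d by linarith
qed

lemma set_PERM:
  assumes "\<sigma> \<in> set_pmf (PERM g n)"
  shows "bij_betw \<sigma> {1..n} {1..n}"
  using assms perm_of_choices_bij choices_valid by (auto simp: PERM_def)

lemma PERM_pattern_density:
  assumes \<tau>: "\<tau> permutes {1..k}" and \<epsilon>: "\<epsilon> > 0"
  shows "(\<lambda>n. measure_pmf.prob (PERM g n)
    {\<sigma>. \<bar>pattern_density k \<tau> n \<sigma> - fact k * limit_density k \<tau>\<bar> > \<epsilon>}) \<longlonglongrightarrow> 0"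
proof -
  define K where "K = 2 * fact k * real (k\<^sup>2)"
  have K: "K \<ge> 0" by (simp add: K_def)
  \<comment> \<open>The mesh is fixed before the tolerance \<eta>, which has to beat the number of
    placements on that mesh. The 6 yields 2 K / N \<le> \<epsilon> / 3.\<close>
  obtain N where N: "N > 0" "6 * K / \<epsilon> < real N"
    using reals_Archimedean2[of "max 1 (6 * K / \<epsilon>)"] by (metis max_less_iff_conj of_nat_0_less_iff zero_less_one order_less_trans)
  then have KN: "K * (2 / real N) \<le> \<epsilon> / 3" using \<epsilon> by (simp add: field_simps)
  define C where "C = fact k * (real (card (pattern_cells k \<tau> N)) * (real k * 4))"
  have C: "C \<ge> 0" by (simp add: C_def)
  \<comment> \<open>The summand 1 guards against C = 0, which occurs for k = 0.\<close>
  define \<eta> where "\<eta> = \<epsilon> / (3 * (C + 1))"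
  have \<eta>: "\<eta> > 0" using C \<epsilon> by (simp add: \<eta>_def)
  have C\<eta>: "C * \<eta> \<le> \<epsilon> / 3"
    using C \<epsilon> by (simp add: \<eta>_def field_simps)
  let ?R = "\<lambda>n. real n ^ k / real (n choose k)"
  let ?bad = "\<lambda>n a b. {\<sigma>. \<bar>emp_cdf n \<sigma> (real a / N) (real b / N) - F_fun g (real a / N) (real b / N)\<bar> > \<eta>}"
  have lim: "(\<lambda>n. \<Sum>a\<le>N. \<Sum>b\<le>N. measure_pmf.prob (PERM g n) (?bad n a b)) \<longlonglongrightarrow> 0"
    using \<eta> N by (intro tendsto_null_sum emp_cdf_tendsto) (auto simp: divide_le_eq)
  have "(\<lambda>n. \<bar>?R n - fact k\<bar> + K * (1 / real n)) \<longlonglongrightarrow> \<bar>fact k - fact k\<bar> + K * 0"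
    by (intro tendsto_intros power_over_binomial_tendsto lim_1_over_n)
  then have "\<forall>\<^sub>F n in sequentially. \<bar>?R n - fact k\<bar> + K * (1 / real n) < \<epsilon> / 3"
    using \<epsilon> by (intro order_tendstoD(2)) auto
  with eventually_gt_at_top[of 0]
  have "\<forall>\<^sub>F n in sequentially. norm (measure_pmf.prob (PERM g n)
      {\<sigma>. \<bar>pattern_density k \<tau> n \<sigma> - fact k * limit_density k \<tau>\<bar> > \<epsilon>}) \<le>
    (\<Sum>a\<le>N. \<Sum>b\<le>N. measure_pmf.prob (PERM g n) (?bad n a b))"
  proof eventually_elim
    case (elim n)
    have "measure_pmf.prob (PERM g n) {\<sigma>. \<bar>pattern_density k \<tau> n \<sigma> - fact k * limit_density k \<tau>\<bar> > \<epsilon>}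
      \<le> measure_pmf.prob (PERM g n) (\<Union>a\<in>{..N}. \<Union>b\<in>{..N}. ?bad n a b)"
    proof (rule measure_pmf.finite_measure_mono_AE)
      show "AE \<sigma> in measure_pmf (PERM g n).
          \<sigma> \<in> {\<sigma>. \<bar>pattern_density k \<tau> n \<sigma> - fact k * limit_density k \<tau>\<bar> > \<epsilon>} \<longrightarrow>
          \<sigma> \<in> (\<Union>a\<in>{..N}. \<Union>b\<in>{..N}. ?bad n a b)"
      proof (rule AE_pmfI, rule impI, rule ccontr)
        fix \<sigma> assume \<sigma>: "\<sigma> \<in> set_pmf (PERM g n)"
          and big: "\<sigma> \<in> {\<sigma>. \<bar>pattern_density k \<tau> n \<sigma> - fact k * limit_density k \<tau>\<bar> > \<epsilon>}"
          and good: "\<sigma> \<notin> (\<Union>a\<in>{..N}. \<Union>b\<in>{..N}. ?bad n a b)"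
        have close: "\<bar>emp_cdf n \<sigma> (real a / N) (real b / N) - F_fun g (real a / N) (real b / N)\<bar> \<le> \<eta>"
          if "a \<le> N" "b \<le> N" for a b
          using good that by (auto simp: not_less)
        define q where "q = real (card (pattern_tuples k \<tau> n \<sigma>)) / real n ^ k"
        define L where "L = limit_density k \<tau>"
        have "\<bar>q - L\<bar> \<le> 2 * real (k\<^sup>2) * (2 / real N + 1 / real n) +
            real (card (pattern_cells k \<tau> N)) * (real k * (4 * \<eta>))"
          unfolding q_def L_def by (rule count_vs_limit[OF \<tau> elim(1) N(1) set_PERM[OF \<sigma>] close])
        then have "fact k * \<bar>q - L\<bar> \<le> fact k * (2 * real (k\<^sup>2) * (2 / real N + 1 / real n) +
            real (card (pattern_cells k \<tau> N)) * (real k * (4 * \<eta>)))"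
          by (rule mult_left_mono) simp
        also have "\<dots> = K * (2 / real N) + K * (1 / real n) + C * \<eta>"
          by (simp add: K_def C_def algebra_simps)
        finally have ql: "fact k * \<bar>q - L\<bar> \<le> K * (2 / real N) + K * (1 / real n) + C * \<eta>" .
        have "0 \<le> q" by (simp add: q_def)
        have "q \<le> 1"
        proof -
          have "pattern_tuples k \<tau> n \<sigma> \<subseteq> {1..k} \<rightarrow>\<^sub>E {1..n}"
            unfolding pattern_tuples_def increasing_tuples_def by blast
          then have "card (pattern_tuples k \<tau> n \<sigma>) \<le> card ({1..k} \<rightarrow>\<^sub>E {1..n})"
            by (intro card_mono finite_PiE) auto
          also have "\<dots> = n ^ k" by (simp add: card_PiE)
          finally have "real (card (pattern_tuples k \<tau> n \<sigma>)) \<le> real (n ^ k)" by (simp only: of_nat_le_iff)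
          then show ?thesis using elim(1) by (simp add: q_def divide_le_eq)
        qed
        have pd: "pattern_density k \<tau> n \<sigma> = q * ?R n"
          unfolding pattern_density_def pattern_tuples_def[symmetric] card_increasing_tuples q_def
          using elim(1) by simp
        \<comment> \<open>Separates the error of the normalisation, damped by q \<le> 1, from the
          error of the sampled pattern probability.\<close>
        have "q * ?R n - fact k * L = q * (?R n - fact k) + fact k * (q - L)" by (simp add: algebra_simps)
        then have 1: "\<bar>q * ?R n - fact k * L\<bar> \<le> \<bar>q * (?R n - fact k)\<bar> + \<bar>fact k * (q - L)\<bar>"
          by (simp only: abs_triangle_ineq)
        have 2: "\<bar>q * (?R n - fact k)\<bar> \<le> \<bar>?R n - fact k\<bar>"
          unfolding abs_mult using \<open>0 \<le> q\<close> \<open>q \<le> 1\<close> by (intro mult_left_le_one_le) auto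
        have 3: "\<bar>fact k * (q - L)\<bar> = fact k * \<bar>q - L\<bar>" by (simp add: abs_mult)
        have "\<bar>q * ?R n - fact k * L\<bar> \<le> \<epsilon>"
          using order.trans[OF 1 add_mono[OF 2 order.trans[OF eq_refl[OF 3] ql]]] KN C\<eta> elim(2)
          by linarith
        then show False using big by (simp add: pd L_def)
      qed
    qed auto
    also have "\<dots> \<le> (\<Sum>a\<le>N. measure_pmf.prob (PERM g n) (\<Union>b\<in>{..N}. ?bad n a b))"
      by (rule measure_pmf.finite_measure_subadditive_finite) auto
    also have "\<dots> \<le> (\<Sum>a\<le>N. \<Sum>b\<le>N. measure_pmf.prob (PERM g n) (?bad n a b))"
      by (intro sum_mono measure_pmf.finite_measure_subadditive_finite) auto
    finally show ?case by simp
  qed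
  then show ?thesis using lim by (rule Lim_null_comparison)
qed

end

theorem corollary2p11:
  fixes g g' :: "real \<Rightarrow> real"
    and M :: "nat \<Rightarrow> 'a measure"
    and \<sigma> :: "nat \<Rightarrow> 'a \<Rightarrow> nat \<Rightarrow> nat"
    and k :: nat
    and \<tau> :: "nat \<Rightarrow> nat"
  assumes "strict_antimono_on {0..1} g"
    and "\<And>x. x \<in> {0..1} \<Longrightarrow> (g has_real_derivative g' x) (at x within {0..1})"
    and "continuous_on {0..1} g'"
    and "g 0 = 1"
    and "g 1 = 0"
    and "\<And>n. n \<ge> 1 \<Longrightarrow> prob_space (M n)"
    and "\<And>n. n \<ge> 1 \<Longrightarrow> \<sigma> n \<in> measurable (M n) (count_space UNIV)"
    and "\<And>n. n \<ge> 1 \<Longrightarrow> distr (M n) (count_space UNIV) (\<sigma> n) = measure_pmf (PERM g n)"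
    and "\<tau> permutes {1..k}"
  shows "tendsto_in_prob M (\<lambda>n \<omega>. pattern_density k \<tau> n (\<sigma> n \<omega>))
           (permuton_pattern_density k \<tau> (mu_perm g))"
proof -
  interpret profile g g' using assms(1-5) by unfold_locales auto
  show ?thesis
    unfolding tendsto_in_prob_def permuton_pattern_density_eq[OF assms(9)]
  proof (intro allI impI)
    fix \<epsilon> :: real assume \<epsilon>: "\<epsilon> > 0"
    let ?S = "\<lambda>n. {\<sigma>. \<bar>pattern_density k \<tau> n \<sigma> - fact k * limit_density k \<tau>\<bar> > \<epsilon>}"
    \<comment> \<open>Passing to the common law removes the underlying spaces. Nothing is known
      about \<open>M 0\<close>, so the equality starts at n = 1.\<close>
    have eq: "measure (M n) {\<omega> \<in> space (M n). \<bar>pattern_density k \<tau> n (\<sigma> n \<omega>) - fact k * limit_density k \<tau>\<bar> > \<epsilon>}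
        = measure_pmf.prob (PERM g n) (?S n)" if n: "n \<ge> 1" for n
    proof -
      have "measure (distr (M n) (count_space UNIV) (\<sigma> n)) (?S n) =
          measure (M n) (\<sigma> n -` ?S n \<inter> space (M n))"
        by (rule measure_distr[OF assms(7)[OF n]]) simp
      moreover have "\<sigma> n -` ?S n \<inter> space (M n) =
          {\<omega> \<in> space (M n). \<bar>pattern_density k \<tau> n (\<sigma> n \<omega>) - fact k * limit_density k \<tau>\<bar> > \<epsilon>}" by auto
      ultimately show ?thesis by (simp add: assms(8)[OF n])
    qed
    show "(\<lambda>n. measure (M n) {\<omega> \<in> space (M n).
        \<bar>pattern_density k \<tau> n (\<sigma> n \<omega>) - fact k * limit_density k \<tau>\<bar> > \<epsilon>}) \<longlonglongrightarrow> 0"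
      using PERM_pattern_density[OF assms(9) \<epsilon>]
      by (rule Lim_transform_eventually) (use eq in \<open>auto intro!: eventually_mono[OF eventually_ge_at_top[of 1]]\<close>)
  qed
qed

end
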